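(* Let $q$ be a prime power and $n\geq 3$. Let $L$ be a maximum scattered $\mathbb{F}_q$-linear set of $\Lambda=PG(3,q^n)$ having at least two lines of pseudoregulus type. Then $L$ is projectively equivalent (under $P\Gamma L(4,q^n)$) to $$L_{s,t}=\{\langle (x,x^{q^s},y,y^{q^t})\rangle : x,y\in\mathbb{F}_{q^n},\ (x,y)\neq(0,0)\}$$ for some $s,t\in\{1,\dots,n-1\}$ with $\gcd(s,n)=\gcd(t,n)=1$. Moreover, $L_{s,t}$ is of pseudoregulus type if and only if either $s=t$ or $s=n-t$. On the other hand, if $s\neq t$ and $s\neq n-t$, then $n\geq 5$ and the only long lines of $L_{s,t}$ are the two lines $X_2=X_3=0$ and $X_0=X_1=0$.
   Context: Let $V$ be a vector space over $\mathbb{F}_{q^n}$ and $\Lambda=PG(V,\mathbb{F}_{q^n})$. An $\mathbb{F}_q$-linear set of $\Lambda$ is a set $L_U=\{\langle \mathbf{u}\rangle_{\mathbb{F}_{q^n}} : \mathbf{u}\in U\setminus\{\mathbf{0}\}\}$ where $U$ is an $\mathbb{F}_q$-subspace of $V$; its rank is $\dim_{\mathbb{F}_q}U$. For a subspace $\Omega=PG(W,\mathbb{F}_{q^n})$, the weight of $\Omega$ in $L_U$ is $\dim_{\mathbb{F}_q}(W\cap U)$. $L_U$ is scattered if every point has weight $1$ in $L_U$; a scattered $\mathbb{F}_q$-linear set of $PG(r-1,q^n)$ is maximum scattered if its rank is $rn/2$ (so rank $2n$ in $PG(3,q^n)$). If $L$ is a scattered $\mathbb{F}_q$-linear set, a line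 of weight $n$ in $L$ is a long line of $L$. A scattered $\mathbb{F}_q$-linear set $L$ of $PG(3,q^n)$ of rank $2n$ is of pseudoregulus type if (i) there exist $q^n+1$ pairwise disjoint long lines $s_1,\dots,s_{q^n+1}$ of $L$, and (ii) there exist exactly two lines $T_1,T_2$ of $PG(3,q^n)$ disjoint from $L$ such that $T_j\cap s_i\neq\emptyset$ for all $i$ and $j=1,2$. On the projective line $PG(1,q^n)=PG(V,\mathbb{F}_{q^n})$, an $\mathbb{F}_q$-linear set is of pseudoregulus type if it equals $\{\langle\lambda\mathbf{w}+\rho\lambda^{\tau}\mathbf{v}\rangle:\lambda\in\mathbb{F}_{q^n}^*\}$ for some linearly independent $\mathbf{w},\mathbf{v}\in V$, some $\rho\in\mathbb{F}_{q^n}^*$ and some automorphism $\tau$ of $\mathbb{F}_{q^n}$ with fixed field $\mathbb{F}_q$. If $L$ is an $\mathbb{F}_q$-linear set of $PG(3,q^n)$, a line $r$ is of pseudoregulus type (with respect to $L$) if $L\cap r$ is an $\mathbb{F}_q$-linear set of pseudoregulus type of the line $r$. *)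

theory Defs
  imports "HOL-Analysis.Analysis"
begin

text \<open>
  The extension \<open>F_q \<subseteq> F_{q^n}\<close> is given by two finite fields \<open>'k\<close> (of order \<open>q\<close>) and \<open>'a\<close>
  (of order \<open>q^n\<close>) and a field homomorphism \<open>h :: 'k \<Rightarrow> 'a\<close>, so that the library's \<open>dim\<close> and
  \<open>subspace\<close> apply to \<open>F_q\<close>-subspaces as well as to \<open>F_{q^n}\<close>-subspaces (\<open>vec.dim\<close>,
  \<open>vec.subspace\<close>). \<open>PG(r-1, q^n)\<close> is the projective space of \<open>'a ^ 'd\<close> with
  \<open>r = CARD('d)\<close>, and its subspaces (points, lines, \<dots>) are represented by the corresponding
  linear subspaces of \<open>'a ^ 'd\<close>.
\<close>

definition field_hom :: "('k::field \<Rightarrow> 'a::field) \<Rightarrow> bool" where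
  "field_hom h \<longleftrightarrow>
     h 1 = 1 \<and> (\<forall>x y. h (x + y) = h x + h y) \<and> (\<forall>x y. h (x * y) = h x * h y)"

definition field_aut :: "('a::field \<Rightarrow> 'a) \<Rightarrow> bool" where
  "field_aut \<sigma> \<longleftrightarrow> field_hom \<sigma> \<and> bij \<sigma>"

definition fq_scale :: "('k::field \<Rightarrow> 'a::field) \<Rightarrow> 'k \<Rightarrow> 'a ^ 'd \<Rightarrow> 'a ^ 'd" where
  "fq_scale h c v = h c *s v"

lemma vector_space_fq_scale: "field_hom h \<Longrightarrow> vector_space (fq_scale h)"
  by unfold_locales
    (auto simp: field_hom_def fq_scale_def vec_eq_iff algebra_simps)

definition fq_subspace :: "('k::field \<Rightarrow> 'a::field) \<Rightarrow> ('a ^ 'd) set \<Rightarrow> bool" where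
  "fq_subspace h U \<longleftrightarrow> module.subspace (fq_scale h) U"

definition fq_dim :: "('k::field \<Rightarrow> 'a::field) \<Rightarrow> ('a ^ 'd) set \<Rightarrow> nat" where
  "fq_dim h U = vector_space.dim (fq_scale h) U"

definition pg_point :: "('a::field ^ 'd) set \<Rightarrow> bool" where
  "pg_point P \<longleftrightarrow> vec.subspace P \<and> vec.dim P = 1"

definition pg_line :: "('a::field ^ 'd) set \<Rightarrow> bool" where
  "pg_line W \<longleftrightarrow> vec.subspace W \<and> vec.dim W = 2"

definition points_of :: "('a::field ^ 'd) set \<Rightarrow> ('a ^ 'd) set set" where
  "points_of W = {P. pg_point P \<and> P \<subseteq> W}"

definition linear_set :: "('a::field ^ 'd) set \<Rightarrow> ('a ^ 'd) set set" where
  "linear_set U = {vec.span {u} | u. u \<in> U - {0}}"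

text \<open>
  Weights, and the notions based on them, take the \<open>F_q\<close>-subspace \<open>U\<close> defining the linear set
  \<open>L_U\<close> as an argument.
\<close>

definition weight :: "('k::field \<Rightarrow> 'a::field) \<Rightarrow> ('a ^ 'd) set \<Rightarrow> ('a ^ 'd) set \<Rightarrow> nat" where
  "weight h U W = fq_dim h (W \<inter> U)"

definition scattered :: "('k::field \<Rightarrow> 'a::field) \<Rightarrow> ('a ^ 'd) set \<Rightarrow> bool" where
  "scattered h U \<longleftrightarrow> fq_subspace h U \<and> (\<forall>P \<in> linear_set U. weight h U P = 1)"

definition max_scattered :: "('k::field \<Rightarrow> 'a::field) \<Rightarrow> nat \<Rightarrow> ('a ^ 'd) set \<Rightarrow> bool" where
  "max_scattered h n U \<longleftrightarrow> scattered h U \<and> 2 * fq_dim h U = CARD('d) * n"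

definition long_line ::
    "('k::field \<Rightarrow> 'a::field) \<Rightarrow> nat \<Rightarrow> ('a ^ 'd) set \<Rightarrow> ('a ^ 'd) set \<Rightarrow> bool" where
  "long_line h n U W \<longleftrightarrow> pg_line W \<and> weight h U W = n"

definition pseudoregulus_type ::
    "('k::field \<Rightarrow> 'a::field) \<Rightarrow> nat \<Rightarrow> ('a ^ 4) set \<Rightarrow> bool" where
  "pseudoregulus_type h n U \<longleftrightarrow>
     scattered h U \<and> fq_dim h U = 2 * n \<and>
     (\<exists>S. (\<forall>s\<in>S. long_line h n U s) \<and> card S = CARD('a) + 1 \<and>
          (\<forall>s\<in>S. \<forall>s'\<in>S. s \<noteq> s' \<longrightarrow> points_of s \<inter> points_of s' = {}) \<and>
          (\<exists>T1 T2. T1 \<noteq> T2 \<and>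
             {T. pg_line T \<and> points_of T \<inter> linear_set U = {} \<and>
                 (\<forall>s\<in>S. points_of T \<inter> points_of s \<noteq> {})} = {T1, T2}))"

text \<open>
  The point set \<open>M\<close> is a linear set of pseudoregulus type of the line \<open>W\<close>. The fixed field
  \<open>F_q\<close> of \<open>\<tau>\<close> is the image of \<open>h\<close>.
\<close>

definition pseudoregulus_type_on_line ::
    "('k::field \<Rightarrow> 'a::field) \<Rightarrow> ('a ^ 'd) set \<Rightarrow> ('a ^ 'd) set set \<Rightarrow> bool" where
  "pseudoregulus_type_on_line h W M \<longleftrightarrow>
     (\<exists>w\<in>W. \<exists>v\<in>W. \<exists>\<rho> \<tau>.
        w \<noteq> v \<and> vec.independent {w, v} \<and> \<rho> \<noteq> 0 \<and>
        field_aut \<tau> \<and> {x. \<tau> x = x} = range h \<and>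
        M = {vec.span {c *s w + (\<rho> * \<tau> c) *s v} | c. c \<noteq> 0})"

definition line_of_pseudoregulus_type ::
    "('k::field \<Rightarrow> 'a::field) \<Rightarrow> ('a ^ 'd) set set \<Rightarrow> ('a ^ 'd) set \<Rightarrow> bool" where
  "line_of_pseudoregulus_type h L r \<longleftrightarrow>
     pg_line r \<and> pseudoregulus_type_on_line h r (L \<inter> points_of r)"

definition semilinear_bij :: "('a::field \<Rightarrow> 'a) \<Rightarrow> ('a ^ 'd \<Rightarrow> 'a ^ 'd) \<Rightarrow> bool" where
  "semilinear_bij \<sigma> f \<longleftrightarrow>
     field_aut \<sigma> \<and> bij f \<and> (\<forall>u v. f (u + v) = f u + f v) \<and> (\<forall>c v. f (c *s v) = \<sigma> c *s f v)"

text \<open>Equivalence of point sets under the group \<open>P\<Gamma>L\<close>, acting by \<open>P \<mapsto> f(P)\<close>.\<close>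

definition proj_equivalent :: "('a::field ^ 'd) set set \<Rightarrow> ('a ^ 'd) set set \<Rightarrow> bool" where
  "proj_equivalent L L' \<longleftrightarrow> (\<exists>\<sigma> f. semilinear_bij \<sigma> f \<and> (\<lambda>P. f ` P) ` L = L')"

text \<open>
  \<open>L_{s,t} = linear_set (U_st q s t)\<close>. The components of \<open>vector [\<dots>]\<close> are numbered from \<open>1\<close>, so
  that the homogeneous coordinates \<open>X_0, X_1, X_2, X_3\<close> of \<open>v\<close> are \<open>v $ 1, v $ 2, v $ 3, v $ 4\<close>.
\<close>

definition U_st :: "nat \<Rightarrow> nat \<Rightarrow> nat \<Rightarrow> ('a::field ^ 4) set" where
  "U_st q s t = {vector [x, x ^ (q ^ s), y, y ^ (q ^ t)] | x y. True}"

lemma vector_4_nth: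
  "(vector [a, b, c, d] :: 'a::zero ^ 4) $ 1 = a" "(vector [a, b, c, d] :: 'a ^ 4) $ 2 = b"
  "(vector [a, b, c, d] :: 'a ^ 4) $ 3 = c" "(vector [a, b, c, d] :: 'a ^ 4) $ 4 = d"
  by (simp_all add: vector_def)

end

theory Submission
  imports Defs "HOL-Number_Theory.Cong"
begin

text \<open>
  On a line of pseudoregulus type \<open>U\<close> is the graph of an \<open>F_q\<close>-linear map \<open>f\<close>, and, up to a scalar,
  the quotients \<open>f(x)/x\<close> run evenly over the elements of norm 1, because \<open>\<tau>(c)/c\<close> has norm 1. A
  theorem of Payne and Hou then forces \<open>f(x) = b x^{q^k}\<close> with \<open>gcd(k, n) = 1\<close>: write
  \<open>f(x) = \<Sum>i<n. a_i x^{q^i}\<close> and take a shortest list of exponents \<open>i\<close> with \<open>a_i \<noteq> 0\<close> whose sum is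
  divisible by \<open>n\<close>. If its length were less than \<open>n\<close>, let \<open>S\<close> be the set of its partial sums modulo
  \<open>n\<close>. The power sum of \<open>f(x)/x\<close> with exponent \<open>\<Sum>s\<in>S. q^s\<close> vanishes; but by uniqueness of base
  \<open>q\<close> expansions it is a sum over permutations of \<open>S\<close>, and minimality leaves a single nonzero term.
  So every such list has length at least \<open>n\<close>, and only one coefficient is nonzero.

  If two distinct lines of weight \<open>n\<close> met in a point \<open>P\<close>, then for a fixed \<open>c\<close> outside \<open>F_q\<close> each
  vector of \<open>P\<close> would be \<open>c u - u'\<close> with \<open>u, u' \<in> U\<close> on the one line and also on the other; as \<open>U\<close>
  is scattered, \<open>u\<close> and \<open>u'\<close> lie in \<open>P \<inter> U\<close>, which yields at most \<open>q^2 < q^n\<close> vectors. Hence \<open>U\<close>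
  is the direct sum of its parts on the two lines, which gives the normal form. Any further long
  line of \<open>L_{s,t}\<close> is the graph of a linear map between the two given ones, and comparing
  coefficients of \<open>x^{q^i}\<close> determines these maps.
\<close>

subsection \<open>Finite fields and base-\<open>q\<close> expansions\<close>

lemma (in vector_space) card_span_independent:
  assumes "finite B" "independent B"
  shows "card (span B) = CARD('a) ^ card B"
  using assms
proof (induction B)
  case (insert b B)
  have b: "b \<notin> span B" and B: "independent B"
    using insert.prems insert.hyps independent_insert by auto
  let ?g = "\<lambda>(k, x). scale k b + x"
  have "span (insert b B) = ?g ` (UNIV \<times> span B)"
  proof -
    have "y \<in> ?g ` (UNIV \<times> span B)" if "y - scale k b \<in> span B" for y k
      using that by (intro image_eqI[of _ _ "(k, y - scale k b)"]) auto
    then show ?thesis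
      by (auto simp: span_insert)
        (metis add_diff_cancel_left')
  qed
  moreover have "inj_on ?g (UNIV \<times> span B)"
  proof (rule inj_onI, clarsimp)
    fix k x l y
    assume xy: "x \<in> span B" "y \<in> span B" and e: "scale k b + x = scale l b + y"
    have "scale (k - l) b = y - x"
      using e by (simp add: scale_left_diff_distrib algebra_simps)
    then have "scale (k - l) b \<in> span B"
      using xy span_diff by metis
    then have "scale (inverse (k - l)) (scale (k - l) b) \<in> span B"
      by (rule span_scale)
    then have "k = l"
      using b by (cases "k = l") auto
    then show "k = l \<and> x = y"
      using e by simp
  qed
  ultimately have "card (span (insert b B)) = CARD('a) * card (span B)"
    by (simp add: card_image card_cartesian_product)
  then show ?case
    using insert.IH[OF B] insert.hyps by simp
qed simp

text \<open>Turns dimensions into cardinalities, so that F_q-subspaces and F_{q^n}-subspaces of the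
  same space can be compared by counting.\<close>

lemma (in vector_space) card_subspace:
  assumes "subspace S" "finite S"
  shows "card S = CARD('a) ^ dim S"
proof -
  obtain B where B: "B \<subseteq> S" "independent B" "S \<subseteq> span B" "card B = dim S"
    using basis_exists .
  then have "span B = S"
    using assms(1) span_minimal by blast
  then show ?thesis
    using card_span_independent[of B] B assms(2) finite_subset by metis
qed

text \<open>Meant for quotient maps such as x -> f(x)/x on nonzero elements, whose fibres all have q
  - 1 elements.\<close>

lemma sum_constant_fibres:
  fixes F :: "'b \<Rightarrow> 'c::semiring_1"
  assumes "finite S" and "\<And>y. y \<in> g ` S \<Longrightarrow> card {x \<in> S. g x = y} = k"
  shows "(\<Sum>x\<in>S. F (g x)) = of_nat k * (\<Sum>y\<in>g ` S. F y)"
proof -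
  have "(\<Sum>x\<in>S. F (g x)) = (\<Sum>y\<in>g ` S. \<Sum>x\<in>{x \<in> S. g x = y}. F (g x))"
    by (rule sum.image_gen[OF assms(1)])
  also have "\<dots> = (\<Sum>y\<in>g ` S. of_nat k * F y)"
    by (intro sum.cong refl) (simp add: assms(2))
  finally show ?thesis
    by (simp add: sum_distrib_left)
qed

lemma card_constant_fibres:
  assumes "finite S" and "\<And>y. y \<in> g ` S \<Longrightarrow> card {x \<in> S. g x = y} = k"
  shows "card S = k * card (g ` S)"
  using sum_constant_fibres[OF assms, of "\<lambda>_. 1 :: nat"] by simp

text \<open>Multiplication by \<open>x\<close> permutes the nonzero elements and so leaves their
  product unchanged.\<close>

lemma finite_field_power_eq_1:
  fixes x :: "'a::{field,finite}"
  assumes "x \<noteq> 0"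
  shows "x ^ (CARD('a) - 1) = 1"
proof -
  have "(\<Prod>y\<in>UNIV-{0}. x * y) = (\<Prod>y\<in>UNIV-{0}. y)"
    by (rule prod.reindex_bij_witness[of _ "\<lambda>y. y / x" "\<lambda>y. x * y"]) (use assms in auto)
  then have "x ^ (CARD('a) - 1) * \<Prod>(UNIV-{0}) = 1 * \<Prod>(UNIV-{0::'a})"
    by (simp add: prod.distrib)
  then show ?thesis
    by simp
qed

lemma of_nat_card_eq_0: "of_nat CARD('a) = (0 :: 'a::{field,finite})"
proof -
  have "(\<Sum>x\<in>UNIV. x + 1) = (\<Sum>x\<in>UNIV. x :: 'a)"
    by (rule sum.reindex_bij_witness[of _ "\<lambda>y. y - 1" "\<lambda>y. y + 1"]) auto
  then show ?thesis
    by (simp add: sum.distrib)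
qed

lemma card_roots_of_unity_le:
  assumes "k > 0"
  shows "finite {x::'a::idom. x ^ k = 1}" "card {x::'a::idom. x ^ k = 1} \<le> k"
proof -
  define p :: "'a poly" where "p = monom 1 k - 1"
  have "coeff p k = 1"
    using assms by (simp add: p_def)
  then have p: "p \<noteq> 0" by auto
  have "degree p \<le> k"
    unfolding p_def by (intro degree_diff_le degree_monom_le) auto
  moreover have "{x. x ^ k = 1} = {x. poly p x = 0}"
    by (simp add: p_def poly_monom)
  ultimately show "finite {x::'a. x ^ k = 1}" "card {x::'a::idom. x ^ k = 1} \<le> k"
    using card_poly_roots_bound[OF p] poly_roots_finite[OF p] by auto
qed

lemma power_cong_card:
  fixes x :: "'a::{field,finite}"
  assumes "x \<noteq> 0" "[a = b] (mod (CARD('a) - 1))"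
  shows "x ^ a = x ^ b"
proof -
  have "x ^ c = x ^ (c mod (CARD('a) - 1))" for c
  proof -
    have "x ^ c = x ^ ((CARD('a) - 1) * (c div (CARD('a) - 1)) + c mod (CARD('a) - 1))"
      by simp
    then show ?thesis
      by (simp only: power_add power_mult finite_field_power_eq_1[OF assms(1)]) simp
  qed
  then show ?thesis
    using assms(2) unfolding cong_def by metis
qed

text \<open>After reduction modulo the order of the multiplicative group, exponents c < d that agree
  everywhere would make all nonzero elements roots of X^{d-c} - 1, more than its degree
  allows.\<close>

lemma ex_power_neq:
  assumes "\<not> [a = b] (mod (CARD('a::{field,finite}) - 1))"
  shows "\<exists>x::'a. x \<noteq> 0 \<and> x ^ a \<noteq> x ^ b"
proof -
  let ?N = "CARD('a) - 1"
  have N: "card (UNIV - {0::'a}) = ?N" by simp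
  have "1 \<in> UNIV - {0::'a}" by simp
  then have "0 < ?N"
    unfolding N[symmetric] card_gt_0_iff by (metis empty_iff finite)
  have *: "\<exists>x::'a. x \<noteq> 0 \<and> x ^ c \<noteq> x ^ d" if "c < d" "d < ?N" for c d
  proof (rule ccontr)
    assume "\<not> ?thesis"
    then have A: "x ^ c = x ^ d" if "x \<noteq> 0" for x :: 'a
      using that by metis
    have "x ^ (d - c) = 1" if "x \<noteq> 0" for x :: 'a
    proof -
      have "x ^ c * x ^ (d - c) = x ^ d"
        unfolding power_add[symmetric] using \<open>c < d\<close> by (rule_tac arg_cong) linarith
      then show ?thesis using A[OF that] that by simp
    qed
    then have "UNIV - {0} \<subseteq> {x::'a. x ^ (d - c) = 1}" by auto
    then have "?N \<le> card {x::'a. x ^ (d - c) = 1}"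
      unfolding N[symmetric] by (intro card_mono) simp_all
    also have "\<dots> \<le> d - c"
      using that by (intro card_roots_of_unity_le) simp
    finally have "?N \<le> d - c" .
    then show False using that by simp
  qed
  have lt: "c mod ?N < ?N" for c using \<open>0 < ?N\<close> by simp
  have red: "x ^ (c mod ?N) = x ^ c" if "x \<noteq> 0" for x :: 'a and c
    using that by (intro power_cong_card) (auto simp: cong_def)
  have "a mod ?N \<noteq> b mod ?N" using assms by (simp add: cong_def)
  then show ?thesis
    using *[of "a mod ?N" "b mod ?N"] *[of "b mod ?N" "a mod ?N"] lt red
    by (metis nat_neq_iff)
qed

text \<open>Orthogonality of power characters. For incongruent exponents some g has different powers
  g^a and g^b, and substituting g x for x multiplies the sum by a factor other than 1. Otherwise
  every term is 1, and the number of terms is -1 in the field.\<close>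

lemma sum_power_divide_power:
  "(\<Sum>x\<in>UNIV - {0}. x ^ a / x ^ b :: 'a::{field,finite}) =
     (if [a = b] (mod (CARD('a) - 1)) then -1 else 0)"
proof (cases "[a = b] (mod (CARD('a) - 1))")
  case True
  have "(\<Sum>x\<in>UNIV - {0}. x ^ a / x ^ b :: 'a) = (\<Sum>x\<in>UNIV - {0::'a}. 1)"
    using power_cong_card[OF _ True] by (intro sum.cong) auto
  also have "\<dots> = of_nat (CARD('a) - 1)"
    by simp
  also have "\<dots> = -1"
    using of_nat_card_eq_0[where ?'a = 'a] by (simp add: of_nat_diff Suc_leI)
  finally show ?thesis using True by simp
next
  case False
  then obtain g :: 'a where g: "g \<noteq> 0" "g ^ a \<noteq> g ^ b"
    using ex_power_neq by blast
  let ?s = "\<Sum>x\<in>UNIV - {0}. x ^ a / x ^ b :: 'a"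
  have "?s = (\<Sum>x\<in>UNIV - {0}. (g * x) ^ a / (g * x) ^ b)"
    by (rule sum.reindex_bij_witness[of _ "\<lambda>y. g * y" "\<lambda>y. y / g"]) (use g in auto)
  also have "\<dots> = g ^ a / g ^ b * ?s"
    by (simp add: sum_distrib_left power_mult_distrib)
  finally have "(g ^ a / g ^ b - 1) * ?s = 0"
    by (simp add: algebra_simps)
  then show ?thesis
    using g False by simp
qed

section \<open>Base-q digits modulo q^n - 1\<close>

lemma base_expansion_unique:
  fixes c e :: "nat \<Rightarrow> nat"
  assumes "\<And>i. i < n \<Longrightarrow> c i < q" "\<And>i. i < n \<Longrightarrow> e i < q"
    and "(\<Sum>i<n. c i * q ^ i) = (\<Sum>i<n. e i * q ^ i)" and "i < n"
  shows "c i = e i"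
  using assms
proof (induction n arbitrary: c e i)
  case (Suc n)
  have split: "(\<Sum>i<Suc n. c i * q ^ i) = c 0 + q * (\<Sum>i<n. c (Suc i) * q ^ i)" for c :: "nat \<Rightarrow> nat"
    by (subst sum.lessThan_Suc_shift) (simp add: sum_distrib_left mult_ac)
  have q: "q > 0" using Suc.prems(1)[of 0] by simp
  have eq: "c 0 + q * (\<Sum>i<n. c (Suc i) * q ^ i) = e 0 + q * (\<Sum>i<n. e (Suc i) * q ^ i)"
    using Suc.prems(3) unfolding split .
  have 0: "c 0 = e 0"
    using arg_cong[OF eq, of "\<lambda>x. x mod q"] Suc.prems(1)[of 0] Suc.prems(2)[of 0] by simp
  then have "(\<Sum>i<n. c (Suc i) * q ^ i) = (\<Sum>i<n. e (Suc i) * q ^ i)"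
    using eq q by simp
  then have "c (Suc j) = e (Suc j)" if "j < n" for j
    using Suc.IH[of "\<lambda>i. c (Suc i)" "\<lambda>i. e (Suc i)" j] Suc.prems(1,2) that by simp
  then show ?case
    using 0 Suc.prems(4) by (cases i) auto
qed simp

lemma base_expansion_less:
  fixes c :: "nat \<Rightarrow> nat"
  assumes "\<And>i. i < n \<Longrightarrow> c i < q"
  shows "(\<Sum>i<n. c i * q ^ i) < q ^ n"
  using assms
proof (induction n)
  case (Suc n)
  have "c n * q ^ n + q ^ n \<le> q * q ^ n"
    using Suc.prems[of n] by (metis add.commute lessI less_eq_Suc_le mult_Suc mult_le_mono1)
  then show ?case
    using Suc by simp
qed simp

text \<open>Modulo q^n - 1 carries run cyclically, and each carry lowers the digit sum by q - 1. A
  representation whose digit sum does not exceed that of the reduced one therefore admits no carry,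
  and two reduced nonzero representations agree by uniqueness.\<close>

lemma digit_sum_minimal:
  fixes c e :: "nat \<Rightarrow> nat"
  assumes q: "q \<ge> 2" and e: "\<And>i. i < n \<Longrightarrow> e i < q"
    and "[(\<Sum>i<n. c i * q ^ i) = (\<Sum>i<n. e i * q ^ i)] (mod (q ^ n - 1))"
    and "0 < (\<Sum>i<n. c i)" "(\<Sum>i<n. c i) \<le> (\<Sum>i<n. e i)" and "i < n"
  shows "c i = e i"
  using assms(3-)
proof (induction "\<Sum>i<n. c i" arbitrary: c i rule: less_induct)
  case less
  have pos: "0 < (\<Sum>i<n. d i * q ^ i)" if "0 < (\<Sum>i<n. d i)" for d :: "nat \<Rightarrow> nat"
    using that q by (auto simp: sum_eq_0_iff simp flip: neq0_conv)
  show ?case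
  proof (cases "\<forall>i<n. c i < q")
    case True
    let ?a = "\<Sum>i<n. c i * q ^ i" and ?b = "\<Sum>i<n. e i * q ^ i"
    have "?a < q ^ n" "?b < q ^ n" "0 < ?a" "0 < ?b"
      using True e less.prems by (auto intro!: base_expansion_less pos)
    \<comment> \<open>Both values lie between 1 and q^n - 1. Subtracting 1 moves them below the
      modulus, where congruence is equality; positivity rules out the confusion of 0 with q^n -
      1.\<close>
    moreover have "[?a - 1 = ?b - 1] (mod (q ^ n - 1))"
    proof -
      have "[?a - 1 + 1 = ?b - 1 + 1] (mod (q ^ n - 1))"
        using less.prems(1) \<open>0 < ?a\<close> \<open>0 < ?b\<close> by simp
      then show ?thesis by (simp only: cong_add_rcancel_nat)
    qed
    ultimately have "?a - 1 = ?b - 1"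
      by (intro cong_less_modulus_unique_nat) auto
    then have "?a = ?b" using \<open>0 < ?a\<close> \<open>0 < ?b\<close> by linarith
    then show ?thesis
      using base_expansion_unique[of n c q e i] True e less.prems by blast
  next
    case False
    then obtain j where j: "j < n" "q \<le> c j" by force
    let ?j = "Suc j mod n"
    have j': "?j < n" using j by simp
    \<comment> \<open>One carry: q units of digit \<open>j\<close> become a single unit of its
      cyclic successor. Keeping the two changes as separate summands also covers
      \<open>?j = j\<close>, which occurs for n = 1.\<close>
    define c' where "c' = (\<lambda>i. (if i = j then c i - q else c i) + (if i = ?j then 1 else 0))"
    have *: "(\<Sum>i<n. c' i * w i) + q * w j = (\<Sum>i<n. c i * w i) + w ?j" for w :: "nat \<Rightarrow> nat"
    proof -
      have "(\<Sum>i<n. c' i * w i) + q * w j =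
          (\<Sum>i<n. c' i * w i + (if i = j then q * w i else 0))"
        using j by (simp add: sum.distrib)
      also have "\<dots> = (\<Sum>i<n. c i * w i + (if i = ?j then w i else 0))"
      proof (intro sum.cong refl)
        fix i
        obtain r where "c j = q + r" using j le_Suc_ex by blast
        then show "c' i * w i + (if i = j then q * w i else 0) = c i * w i + (if i = ?j then w i else 0)"
          by (simp add: c'_def algebra_simps)
      qed
      finally show ?thesis
        using j' by (simp add: sum.distrib)
    qed
    have s: "(\<Sum>i<n. c' i) + q = (\<Sum>i<n. c i) + 1"
      using *[of "\<lambda>_. 1"] by simp
    \<comment> \<open>A carry out of the last position wraps around to position 0, because q^n is
      congruent to 1.\<close>
    have qj: "[q ^ ?j = q * q ^ j] (mod (q ^ n - 1))"
    proof (cases "Suc j = n")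
      case True
      have "[1 + 0 = 1 + (q ^ n - 1)] (mod (q ^ n - 1))"
        by (intro cong_add) (simp_all add: cong_def)
      then have "[1 = 1 + (q ^ n - 1)] (mod (q ^ n - 1))"
        by simp
      moreover have "1 + (q ^ n - 1) = q ^ n"
        using q by simp
      moreover have "q ^ ?j = 1" "q * q ^ j = q ^ n"
        using True by (simp, metis power_Suc)
      ultimately show ?thesis by metis
    next
      case False
      then show ?thesis using j by (simp add: cong_def)
    qed
    have "[(\<Sum>i<n. c' i * q ^ i) + q * q ^ j = (\<Sum>i<n. e i * q ^ i) + q * q ^ j] (mod (q ^ n - 1))"
      unfolding *[of "\<lambda>i. q ^ i"] by (intro cong_add less.prems(1) qj)
    then have c': "[(\<Sum>i<n. c' i * q ^ i) = (\<Sum>i<n. e i * q ^ i)] (mod (q ^ n - 1))"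
      by (simp only: cong_add_rcancel_nat)
    have "0 < c' ?j" by (simp add: c'_def)
    then have c'_pos: "0 < (\<Sum>i<n. c' i)"
      using j' member_le_sum[of ?j "{..<n}" c'] by simp
    have "c' i = e i" if "i < n" for i
      by (rule less.hyps) (use c' s less.prems q that c'_pos in simp_all)
    \<comment> \<open>This is absurd: after the carry the digit sum is smaller than that of
      \<open>c\<close>, hence smaller than that of \<open>e\<close>.\<close>
    then have "(\<Sum>i<n. c' i) = (\<Sum>i<n. e i)" by simp
    then show ?thesis using s q less.prems by linarith
  qed
qed

section \<open>The field extension and its Frobenius maps\<close>

locale finite_field_extension =
  fixes h :: "'k::{field,finite} \<Rightarrow> 'a::{field,finite}" and q n :: nat
  assumes field_hom: "field_hom h"
    and card_k: "CARD('k) = q" and card_a: "CARD('a) = q ^ n" and n_pos: "n > 0"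
begin

lemma h_1 [simp]: "h 1 = 1" and h_add: "h (x + y) = h x + h y" and h_mult: "h (x * y) = h x * h y"
  using field_hom by (auto simp: field_hom_def)

lemma h_0 [simp]: "h 0 = 0"
  using h_add[of 0 0] by (metis add.right_neutral add_left_cancel)

lemma h_minus: "h (- x) = - h x"
  using h_add[of x "- x"] by (simp add: eq_neg_iff_add_eq_0 add.commute)

lemma h_diff: "h (x - y) = h x - h y"
  using h_add[of x "- y"] h_minus by simp

lemma h_eq_0_iff [simp]: "h x = 0 \<longleftrightarrow> x = 0"
  using h_mult[of x "inverse x"] by (cases "x = 0") auto

lemma inj_h: "inj h"
  by (rule injI) (metis eq_iff_diff_eq_0 h_diff h_eq_0_iff)

lemma h_power: "h (x ^ i) = h x ^ i"
  by (induction i) (simp_all add: h_mult)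

lemma h_of_nat: "h (of_nat i) = of_nat i"
  by (induction i) (simp_all add: h_add)

lemma card_range_h: "card (range h) = q"
  using card_image[OF inj_h] card_k by simp

lemma q_ge_2: "q \<ge> 2"
proof -
  have "card {0, 1 :: 'k} \<le> CARD('k)" by (intro card_mono) auto
  then show ?thesis using card_k by simp
qed

lemma power_q_k: "(x :: 'k) ^ q = x"
proof (cases "x = 0")
  case False
  have "x ^ Suc (q - 1) = x"
    using finite_field_power_eq_1[OF False] by (simp add: card_k)
  then show ?thesis using q_ge_2 by simp
qed (use q_ge_2 in simp)

lemma power_card_a: "(x :: 'a) ^ (q ^ n) = x"
proof (cases "x = 0")
  case False
  have "x ^ Suc (q ^ n - 1) = x"
    using finite_field_power_eq_1[OF False] by (simp add: card_a)
  then show ?thesis using q_ge_2 by simp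
qed (use q_ge_2 in simp)

text \<open>
  \<open>(X + 1)^q - X^q - 1\<close> has degree less than \<open>q\<close> and vanishes on the whole of \<open>F_q\<close>; hence the
  inner binomial coefficients vanish without any appeal to the characteristic.
\<close>

lemma of_nat_choose_q_eq_0:
  assumes "0 < i" "i < q"
  shows "of_nat (q choose i) = (0 :: 'a)"
proof -
  define p :: "'k poly" where "p = (\<Sum>i\<in>{0<..<q}. monom (of_nat (q choose i)) i)"
  have split: "{..q} = insert 0 (insert q {0<..<q})"
    using q_ge_2 by auto
  have "poly p x = 0" for x
  proof -
    have "x + 1 = (x + 1) ^ q" by (simp add: power_q_k)
    also have "\<dots> = (\<Sum>i\<le>q. of_nat (q choose i) * x ^ i)"
      by (simp add: binomial_ring)
    also have "\<dots> = x ^ q + 1 + poly p x"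
      unfolding split using q_ge_2 by (simp add: p_def poly_sum poly_monom)
    finally show ?thesis by (simp add: power_q_k)
  qed
  moreover have "degree p < q"
    unfolding p_def using q_ge_2 by (intro degree_sum_less) (auto intro: le_less_trans[OF degree_monom_le])
  ultimately have "p = 0"
    using card_poly_roots_bound[of p] card_k by fastforce
  then have "coeff p i = 0" by simp
  then have "of_nat (q choose i) = (0 :: 'k)"
    using assms by (simp add: p_def coeff_sum)
  then show ?thesis
    using h_of_nat by (metis h_0)
qed

lemma frob_add: "(x + y :: 'a) ^ (q ^ i) = x ^ (q ^ i) + y ^ (q ^ i)"
proof (induction i)
  case (Suc i)
  have split: "{..q} = insert 0 (insert q {0<..<q})"
    using q_ge_2 by auto
  have *: "(x + y) ^ q = x ^ q + y ^ q" for x y :: 'a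
    unfolding binomial_ring split using q_ge_2 by (simp add: of_nat_choose_q_eq_0)
  have "(x + y) ^ (q ^ Suc i) = ((x + y) ^ (q ^ i)) ^ q"
    by (simp add: mult.commute flip: power_mult)
  also have "\<dots> = (x ^ (q ^ i)) ^ q + (y ^ (q ^ i)) ^ q"
    by (simp add: Suc *)
  finally show ?case
    by (simp add: mult.commute flip: power_mult)
qed simp

lemma frob_0 [simp]: "(0 :: 'a) ^ (q ^ i) = 0"
  using q_ge_2 by simp

lemma frob_sum: "(\<Sum>x\<in>A. g x :: 'a) ^ (q ^ i) = (\<Sum>x\<in>A. g x ^ (q ^ i))"
  by (induction A rule: infinite_finite_induct) (simp_all add: frob_add)

lemma frob_frob: "((x :: 'a) ^ (q ^ i)) ^ (q ^ j) = x ^ (q ^ (i + j))"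
  by (simp add: power_add flip: power_mult)

lemma frob_h: "h c ^ (q ^ i) = h c"
proof (induction i)
  case (Suc i)
  then show ?case
    by (simp add: power_mult power_q_k flip: h_power)
qed simp

lemma frob_cong:
  assumes "[i = j] (mod n)"
  shows "(x :: 'a) ^ (q ^ i) = x ^ (q ^ j)"
proof -
  have *: "x ^ (q ^ (i + n * l)) = x ^ (q ^ i)" for i l
  proof (induction l)
    case (Suc l)
    have "x ^ (q ^ (i + n * Suc l)) = (x ^ (q ^ (i + n * l))) ^ (q ^ n)"
      by (simp add: frob_frob algebra_simps)
    then show ?case using Suc power_card_a by simp
  qed simp
  have "x ^ (q ^ i) = x ^ (q ^ (i mod n))" for i
    using *[of "i mod n" "i div n"] by simp
  then show ?thesis
    using assms unfolding cong_def by metis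
qed

text \<open>The image of \<open>h\<close> has q elements and consists of roots of X^q - X, so it
  contains all of them. The root 0 is split off, leaving at most q - 1 roots of X^{q-1} - 1.\<close>

lemma frob_1_fixed_iff: "(x :: 'a) ^ q = x \<longleftrightarrow> x \<in> range h"
proof
  have "range h \<subseteq> {x. x = 0 \<or> x ^ (q - 1) = 1}"
  proof -
    have "h c ^ (q - 1) = 1" if "c \<noteq> 0" for c
      using finite_field_power_eq_1[OF that] by (simp add: card_k flip: h_power)
    then have "h c = 0 \<or> h c ^ (q - 1) = 1" for c
      by (cases "c = 0") simp_all
    then show ?thesis by blast
  qed
  moreover have "card {x::'a. x = 0 \<or> x ^ (q - 1) = 1} \<le> q"
  proof -
    have "{x::'a. x = 0 \<or> x ^ (q - 1) = 1} = insert 0 {x. x ^ (q - 1) = 1}"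
      by auto
    then have "card {x::'a. x = 0 \<or> x ^ (q - 1) = 1} \<le> Suc (card {x::'a. x ^ (q - 1) = 1})"
      by (simp add: card_insert_if)
    also have "\<dots> \<le> Suc (q - 1)"
      using card_roots_of_unity_le(2)[of "q - 1", where ?'a = 'a] q_ge_2 by simp
    finally show ?thesis using q_ge_2 by simp
  qed
  ultimately have eq: "range h = {x. x = 0 \<or> x ^ (q - 1) = 1}"
    using card_range_h by (intro card_seteq) auto
  assume "x ^ q = x"
  moreover have "x ^ q = x * x ^ (q - 1)"
    using q_ge_2 by (simp flip: power_Suc)
  ultimately have "x = 0 \<or> x ^ (q - 1) = 1" by auto
  then show "x \<in> range h" using eq by simp
next
  assume "x \<in> range h"
  then show "x ^ q = x" using frob_h[of _ 1] by auto
qed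

text \<open>Choose j with i j congruent to 1 modulo n; applying the given Frobenius power j times
  yields x^q = x.\<close>

lemma frob_fixed:
  assumes "gcd i n = 1" "(x :: 'a) ^ (q ^ i) = x"
  shows "x \<in> range h"
proof -
  have "x ^ (q ^ (i * j)) = x" for j
  proof (induction j)
    case (Suc j)
    have "x ^ (q ^ (i * Suc j)) = (x ^ (q ^ (i * j))) ^ (q ^ i)"
      by (simp add: frob_frob algebra_simps)
    then show ?case using Suc assms by simp
  qed simp
  moreover obtain j where "[i * j = 1] (mod n)"
    using cong_solve_coprime_nat[of i n] assms(1) by (auto simp: coprime_iff_gcd_eq_1)
  ultimately have "x ^ q = x"
    using frob_cong[of "i * j" 1 x] by simp
  then show ?thesis by (simp add: frob_1_fixed_iff)
qed

text \<open>A power of q is an expansion with a single digit 1, so minimality of the digit sum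
  applies to two unit vectors of digits.\<close>

lemma q_power_cong_iff:
  assumes "i < n" "j < n"
  shows "[q ^ i = q ^ j] (mod (q ^ n - 1)) \<longleftrightarrow> i = j"
proof
  let ?e = "\<lambda>j i. if i = j then 1 else 0 :: nat"
  have *: "(\<Sum>l<n. ?e m l * q ^ l) = q ^ m" "(\<Sum>l<n. ?e m l) = 1" if "m < n" for m
    using that by (simp_all add: if_distrib[of "\<lambda>x. x * _"] cong: if_cong)
  assume "[q ^ i = q ^ j] (mod (q ^ n - 1))"
  then have "?e i i = ?e j i"
    using assms q_ge_2
    by (intro digit_sum_minimal[of q n "?e j" "?e i" i]) (simp_all only: * cong_sym_eq[of "q ^ j"], auto)
  then show "i = j" by (simp split: if_splits)
qed simp

text \<open>Dividing by x^{q^j} and summing over all nonzero x isolates the j-th coefficient up to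
  sign, by orthogonality.\<close>

lemma linearized_coefficients_unique:
  assumes "\<And>x::'a. (\<Sum>i<n. a i * x ^ (q ^ i)) = 0" "j < n"
  shows "a j = 0"
proof -
  have "0 = (\<Sum>x\<in>UNIV - {0::'a}. (\<Sum>i<n. a i * x ^ (q ^ i)) / x ^ (q ^ j))"
    by (simp add: assms(1))
  also have "\<dots> = (\<Sum>i<n. a i * (\<Sum>x\<in>UNIV - {0::'a}. x ^ (q ^ i) / x ^ (q ^ j)))"
    unfolding sum_distrib_left sum_divide_distrib
    by (subst sum.swap) simp
  also have "\<dots> = (\<Sum>i<n. if i = j then - a i else 0)"
    using assms(2)
    by (intro sum.cong) (auto simp: sum_power_divide_power card_a q_power_cong_iff[unfolded One_nat_def])
  finally show ?thesis
    using assms(2) by simp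
qed

text \<open>A counting argument: a linear map is determined by its values on an F_q-basis of n
  elements, coefficient vectors give distinct value vectors, and there are (q^n)^n of either. So
  every value vector comes from a linearized polynomial.\<close>

lemma ex_linearized_polynomial:
  fixes f :: "'a \<Rightarrow> 'a"
  assumes add: "\<And>x y. f (x + y) = f x + f y" and scale: "\<And>c x. f (h c * x) = h c * f x"
  obtains a where "\<And>x. f x = (\<Sum>i<n. a i * x ^ (q ^ i))"
proof -
  interpret V: vector_space "\<lambda>c x. h c * x :: 'a"
    by unfold_locales (auto simp: h_add h_mult algebra_simps)
  obtain B where B: "V.independent B" "UNIV \<subseteq> V.span B" "card B = V.dim (UNIV :: 'a set)"
    using V.basis_exists by metis
  have "card (UNIV :: 'a set) = CARD('k) ^ V.dim (UNIV :: 'a set)"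
    by (rule V.card_subspace) auto
  then have "q ^ n = q ^ card B"
    using card_a card_k B by simp
  then have cB: "card B = n"
    using q_ge_2 power_inject_exp[of q n "card B"] by simp
  define L where "L = (\<lambda>a x. \<Sum>i<n. a i * (x :: 'a) ^ (q ^ i))"
  have lin: "g x = 0" if "\<And>x y. g (x + y) = g x + g y" "\<And>c x. g (h c * x) = h c * g x"
      "\<And>x. x \<in> B \<Longrightarrow> g x = 0" for g :: "'a \<Rightarrow> 'a" and x
  proof -
    have "x \<in> V.span B" using B(2) by auto
    then show ?thesis
    proof (induction rule: V.span_induct)
      case base
      show ?case
        using that(2)[of 0 0] by (auto simp: V.subspace_def that(1,2))
    qed (use that in simp)
  qed
  have L_add: "L a (x + y) = L a x + L a y" and L_scale: "L a (h c * x) = h c * L a x" for a x y c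
    by (simp_all add: L_def frob_add power_mult_distrib frob_h algebra_simps sum.distrib sum_distrib_left)
  have L_diff: "L (\<lambda>i. a i - b i) x = L a x - L b x" for a b x
    by (simp add: L_def algebra_simps sum_subtractf)
  let ?r = "\<lambda>a. restrict (L a) B"
  let ?A = "{..<n} \<rightarrow>\<^sub>E (UNIV :: 'a set)" and ?C = "B \<rightarrow>\<^sub>E (UNIV :: 'a set)"
  have "inj_on ?r ?A"
  proof (rule inj_onI)
    fix a b assume ab: "a \<in> ?A" "b \<in> ?A" and eq: "?r a = ?r b"
    have "L (\<lambda>i. a i - b i) x = 0" for x
    proof (rule lin[OF L_add L_scale])
      fix x assume "x \<in> B"
      then show "L (\<lambda>i. a i - b i) x = 0"
        using fun_cong[OF eq, of x] by (simp add: L_diff)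
    qed
    then have "a j - b j = 0" if "j < n" for j
      using linearized_coefficients_unique[of "\<lambda>i. a i - b i" j] that
        \<open>\<And>x. L (\<lambda>i. a i - b i) x = 0\<close> by (simp add: L_def)
    then show "a = b"
      using ab by (intro PiE_ext) auto
  qed
  moreover have "?r ` ?A \<subseteq> ?C" by auto
  moreover have "card ?A = card ?C" "finite ?C"
    by (auto simp: card_funcsetE cB intro: finite_PiE)
  ultimately have "?r ` ?A = ?C"
    by (metis card_image card_subset_eq)
  then obtain a where a: "restrict f B = ?r a"
    by (metis (no_types, lifting) UNIV_I image_iff restrict_PiE_iff)
  have "f x - L a x = 0" for x
  proof (rule lin[of "\<lambda>x. f x - L a x"])
    fix x assume "x \<in> B"
    then show "f x - L a x = 0" using fun_cong[OF a, of x] by simp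
  qed (simp_all add: add scale L_add L_scale right_diff_distrib add_diff_add)
  then show ?thesis
    using that[of a] by (simp add: L_def)
qed

subsection \<open>Linearized polynomials with quotients of norm 1\<close>

text \<open>The exponent of the norm map from F_{q^n} to F_q, equal to (q^n - 1)/(q - 1).\<close>

definition norm_exp :: nat where
  "norm_exp = (\<Sum>i<n. q ^ i)"

lemma norm_exp_mult: "(q - 1) * norm_exp = q ^ n - 1"
proof -
  have "(q - 1) * (\<Sum>i<m. q ^ i) + 1 = q ^ m" for m
  proof (induction m)
    case (Suc m)
    have "(q - 1) * q ^ m + q ^ m = q ^ Suc m"
      using q_ge_2 by (simp add: algebra_simps)
    then show ?case using Suc by (simp add: algebra_simps)
  qed simp
  from this[of n] show ?thesis by (simp add: norm_exp_def)
qed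

lemma norm_exp_pos: "norm_exp > 0"
proof -
  have "q ^ n > 1" using q_ge_2 n_pos by (intro one_less_power) auto
  then show ?thesis using norm_exp_mult by (cases "norm_exp = 0") auto
qed

text \<open>For nonzero x the (q - 1)-st power of the norm is x^{q^n - 1} = 1, so the norm is fixed
  by the Frobenius map.\<close>

lemma power_norm_exp_in_range: "(x :: 'a) ^ norm_exp \<in> range h"
proof (cases "x = 0")
  case False
  then have "x ^ norm_exp \<noteq> 0" by simp
  moreover have "x ^ (norm_exp * (q - 1)) = 1"
    using finite_field_power_eq_1[OF False]
    unfolding mult.commute[of norm_exp] norm_exp_mult card_a .
  ultimately have "(x ^ norm_exp) ^ Suc (q - 1) = x ^ norm_exp"
    by (simp add: power_mult)
  then have "(x ^ norm_exp) ^ q = x ^ norm_exp"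
    using q_ge_2 by simp
  then show ?thesis by (simp add: frob_1_fixed_iff)
next
  case True
  then have "x ^ norm_exp = h 0" using norm_exp_pos by simp
  then show ?thesis by blast
qed

text \<open>The hypotheses identify the fibre with the nonzero F_q-multiples of \<open>x\<close>.
  Serves both quotient maps f(x)/x and \<tau>(c)/c.\<close>

lemma card_fibre_projective:
  assumes "(x :: 'a) \<noteq> 0"
    and "\<And>y. y \<in> S \<Longrightarrow> g y = g x \<Longrightarrow> y / x \<in> range h"
    and "\<And>c. c \<noteq> 0 \<Longrightarrow> h c * x \<in> S \<and> g (h c * x) = g x" and "0 \<notin> S"
  shows "card {y \<in> S. g y = g x} = q - 1"
proof -
  have "{y \<in> S. g y = g x} = (\<lambda>c. h c * x) ` (UNIV - {0})"
  proof
    show "{y \<in> S. g y = g x} \<subseteq> (\<lambda>c. h c * x) ` (UNIV - {0})"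
    proof
      fix y assume y: "y \<in> {y \<in> S. g y = g x}"
      then obtain c where c: "y / x = h c" using assms(2) by blast
      then have "y = h c * x" using assms(1) by (simp add: field_simps)
      moreover have "c \<noteq> 0" using y \<open>y = h c * x\<close> assms(4) by auto
      ultimately show "y \<in> (\<lambda>c. h c * x) ` (UNIV - {0})" by blast
    qed
  qed (use assms(3) in auto)
  moreover have "inj_on (\<lambda>c. h c * x) (UNIV - {0})"
    using assms(1) inj_h by (auto simp: inj_on_def)
  ultimately show ?thesis
    by (simp add: card_image card_k)
qed

text \<open>By counting, \<open>g\<close> takes each element of norm 1 exactly q - 1 times. The
  power sum is thus a multiple of the sum of m^d over the group of these elements, which vanishes
  because d is too small for all of them to satisfy z^d = 1.\<close>

lemma sum_power_norm_one_image:
  fixes g :: "'b \<Rightarrow> 'a"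
  assumes fin: "finite S" and card_S: "card S = q ^ n - 1"
    and fib: "\<And>y. y \<in> g ` S \<Longrightarrow> card {x \<in> S. g x = y} = q - 1"
    and norm: "\<And>x. x \<in> S \<Longrightarrow> g x ^ norm_exp = 1"
  shows "g ` S = {m. m ^ norm_exp = 1}"
    and "0 < d \<Longrightarrow> d < norm_exp \<Longrightarrow> (\<Sum>x\<in>S. g x ^ d) = 0"
proof -
  have "(q - 1) * card (g ` S) = (q - 1) * norm_exp"
    using card_constant_fibres[OF fin fib] card_S norm_exp_mult by metis
  moreover have "0 < q - 1"
    using q_ge_2 by simp
  ultimately have "card (g ` S) = norm_exp"
    by (simp only: nat_mult_eq_cancel1)
  then show im: "g ` S = {m. m ^ norm_exp = 1}"
    using norm card_roots_of_unity_le[OF norm_exp_pos, where ?'a = 'a]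
    by (intro card_seteq) auto
  assume d: "0 < d" "d < norm_exp"
  then have "\<not> {m::'a. m ^ norm_exp = 1} \<subseteq> {m. m ^ d = 1}"
    using card_roots_of_unity_le[of d, where ?'a = 'a] card_mono[of "{m::'a. m ^ d = 1}" "g ` S"]
      im \<open>card (g ` S) = norm_exp\<close> by auto
  then obtain z :: 'a where z: "z ^ norm_exp = 1" "z ^ d \<noteq> 1" by auto
  then have z0: "z \<noteq> 0" using norm_exp_pos by (auto simp: power_0_left)
  let ?s = "\<Sum>m | m ^ norm_exp = 1. m ^ d :: 'a"
  have "?s = (\<Sum>m | m ^ norm_exp = 1. (z * m) ^ d)"
    by (rule sum.reindex_bij_witness[of _ "\<lambda>m. z * m" "\<lambda>m. m / z"])
      (use z z0 in \<open>auto simp: power_mult_distrib power_divide\<close>)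
  also have "\<dots> = z ^ d * ?s"
    by (simp add: power_mult_distrib sum_distrib_left)
  finally have "(z ^ d - 1) * ?s = 0" by (simp add: algebra_simps)
  then have "?s = 0" using z by simp
  then show "(\<Sum>x\<in>S. g x ^ d) = 0"
    using sum_constant_fibres[OF fin fib, of "\<lambda>m. m ^ d"] im by simp
qed

text \<open>
  The coefficient of \<open>x^0\<close> in \<open>(f(x)/x)^d\<close>, \<open>d = \<Sum>s\<in>S. q^s\<close>: only the choices \<open>\<phi>\<close> of exponents
  that preserve \<open>d\<close> modulo \<open>q^n - 1\<close> contribute to the power sum.
\<close>

lemma sum_linearized_quotient_power:
  fixes a :: "nat \<Rightarrow> 'a"
  assumes f: "\<And>x. f x = (\<Sum>i<n. a i * x ^ (q ^ i))" and S: "S \<subseteq> {..<n}"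
  defines "G \<equiv> {\<phi> \<in> S \<rightarrow>\<^sub>E {..<n}. [(\<Sum>s\<in>S. q ^ ((s + \<phi> s) mod n)) = (\<Sum>s\<in>S. q ^ s)] (mod (q ^ n - 1))}"
  shows "(\<Sum>x\<in>UNIV - {0}. (f x / x) ^ (\<Sum>s\<in>S. q ^ s)) = - (\<Sum>\<phi>\<in>G. \<Prod>s\<in>S. a (\<phi> s) ^ (q ^ s))"
proof -
  have fin: "finite S" using S finite_subset by blast
  let ?d = "\<Sum>s\<in>S. q ^ s"
  have e: "(f x / x) ^ ?d =
      (\<Sum>\<phi>\<in>S \<rightarrow>\<^sub>E {..<n}. (\<Prod>s\<in>S. a (\<phi> s) ^ (q ^ s)) *
         (x ^ (\<Sum>s\<in>S. q ^ ((s + \<phi> s) mod n)) / x ^ ?d))" for x :: 'a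
  proof -
    have "f x ^ (q ^ s) = (\<Sum>i<n. a i ^ (q ^ s) * x ^ (q ^ ((s + i) mod n)))" for s
    proof -
      have "(x ^ (q ^ i)) ^ (q ^ s) = x ^ (q ^ ((s + i) mod n))" for i
        unfolding frob_frob by (rule frob_cong) (simp add: cong_def add.commute)
      then show ?thesis
        by (simp add: f frob_sum power_mult_distrib)
    qed
    then have "f x ^ ?d = (\<Prod>s\<in>S. \<Sum>i<n. a i ^ (q ^ s) * x ^ (q ^ ((s + i) mod n)))"
      by (simp add: power_sum)
    also have "\<dots> = (\<Sum>\<phi>\<in>S \<rightarrow>\<^sub>E {..<n}. \<Prod>s\<in>S. a (\<phi> s) ^ (q ^ s) * x ^ (q ^ ((s + \<phi> s) mod n)))"
      using fin by (intro prod_sum_PiE) auto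
    finally show ?thesis
      unfolding power_divide by (simp add: sum_divide_distrib prod.distrib power_sum)
  qed
  have "(\<Sum>x\<in>UNIV - {0}. (f x / x) ^ ?d) =
      (\<Sum>\<phi>\<in>S \<rightarrow>\<^sub>E {..<n}. (\<Prod>s\<in>S. a (\<phi> s) ^ (q ^ s)) *
         (\<Sum>x\<in>UNIV - {0::'a}. x ^ (\<Sum>s\<in>S. q ^ ((s + \<phi> s) mod n)) / x ^ ?d))"
    unfolding e sum_distrib_left by (subst sum.swap) (rule refl)
  also have "\<dots> = (\<Sum>\<phi>\<in>S \<rightarrow>\<^sub>E {..<n}.
      if [(\<Sum>s\<in>S. q ^ ((s + \<phi> s) mod n)) = ?d] (mod (q ^ n - 1))
      then - (\<Prod>s\<in>S. a (\<phi> s) ^ (q ^ s)) else 0)"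
    unfolding sum_power_divide_power card_a by (intro sum.cong refl) auto
  also have "\<dots> = (\<Sum>\<phi>\<in>G. - (\<Prod>s\<in>S. a (\<phi> s) ^ (q ^ s)))"
    unfolding G_def using fin by (subst sum.inter_filter) (auto intro: finite_PiE)
  finally show ?thesis by (simp add: sum_negf)
qed

text \<open>Counting how often \<open>\<psi>\<close> takes each value gives digits with sum
  \<open>card S\<close>, the digit sum of the 0-1 expansion of S. Minimality makes the two digit
  sequences equal.\<close>

lemma q_power_sum_cong_imp_subset:
  assumes S: "S \<subseteq> {..<n}" "S \<noteq> {}" and \<psi>: "\<psi> ` S \<subseteq> {..<n}"
    and cong: "[(\<Sum>s\<in>S. q ^ \<psi> s) = (\<Sum>s\<in>S. q ^ s)] (mod (q ^ n - 1))"
  shows "\<psi> ` S \<subseteq> S"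
proof
  have fin: "finite S" using S finite_subset by blast
  define c where "c = (\<lambda>i. card {s \<in> S. \<psi> s = i})"
  define e where "e = (\<lambda>i. if i \<in> S then 1 else 0 :: nat)"
  have c_sum: "(\<Sum>i<n. c i * w i) = (\<Sum>s\<in>S. w (\<psi> s))" for w :: "nat \<Rightarrow> nat"
  proof -
    have "(\<Sum>s\<in>S. w (\<psi> s)) = (\<Sum>i<n. \<Sum>s | s \<in> S \<and> \<psi> s = i. w (\<psi> s))"
      using fin \<psi> by (intro sum.group[symmetric]) auto
    also have "\<dots> = (\<Sum>i<n. c i * w i)"
      by (intro sum.cong refl) (simp add: c_def)
    finally show ?thesis by simp
  qed
  have e_sum: "(\<Sum>i<n. e i * w i) = (\<Sum>s\<in>S. w s)" for w :: "nat \<Rightarrow> nat"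
  proof -
    have "(\<Sum>i<n. e i * w i) = (\<Sum>i | i \<in> {..<n} \<and> i \<in> S. w i)"
      unfolding e_def by (subst sum.inter_filter) (auto intro: sum.cong)
    also have "{i. i \<in> {..<n} \<and> i \<in> S} = S" using S by auto
    finally show ?thesis .
  qed
  have tot: "(\<Sum>i<n. c i) = card S" "(\<Sum>i<n. e i) = card S"
    using c_sum[of "\<lambda>_. 1"] e_sum[of "\<lambda>_. 1"] by simp_all
  have e_less: "e i < q" for i using q_ge_2 by (simp add: e_def)
  have "card S > 0" using S fin by (simp add: card_gt_0_iff)
  fix j assume "j \<in> \<psi> ` S"
  then obtain s where s: "s \<in> S" "\<psi> s = j" by blast
  have "c j = e j"
    using q_ge_2 s \<psi> \<open>card S > 0\<close> cong
    by (intro digit_sum_minimal[of q n e c j]) (auto simp: c_sum e_sum tot e_less)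
  moreover have "c j > 0"
    using s fin by (auto simp: c_def card_gt_0_iff)
  ultimately show "j \<in> S" by (simp add: e_def split: if_splits)
qed

lemma min_zero_sum_list_length:
  fixes a :: "nat \<Rightarrow> 'a"
  assumes f: "\<And>x. f x = (\<Sum>i<n. a i * x ^ (q ^ i))"
    and vanish: "\<And>d. 0 < d \<Longrightarrow> d < norm_exp \<Longrightarrow> (\<Sum>x\<in>UNIV - {0}. (f x / x) ^ d) = 0"
    and xs: "xs \<noteq> []" "set xs \<subseteq> {i. i < n \<and> a i \<noteq> 0}" "n dvd sum_list xs"
    and min: "\<And>ys. ys \<noteq> [] \<Longrightarrow> set ys \<subseteq> {i. i < n \<and> a i \<noteq> 0} \<Longrightarrow> n dvd sum_list ys \<Longrightarrow>
                length xs \<le> length ys"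
  shows "n \<le> length xs"
proof (rule ccontr)
  assume "\<not> n \<le> length xs"
  define m where "m = length xs"
  have m: "0 < m" "m < n"
    using \<open>\<not> n \<le> length xs\<close> xs(1) by (auto simp: m_def)
  let ?K = "{i. i < n \<and> a i \<noteq> 0}"
  define v where "v = (\<lambda>i. sum_list (take i xs) mod n)"
  have slice: "sum_list (take i xs) + sum_list (drop i (take j xs)) = sum_list (take j xs)"
    if "i \<le> j" for i j
  proof -
    have "take j xs = take i xs @ drop i (take j xs)"
      using that by (metis append_take_drop_id min.absorb1 take_take)
    then show ?thesis by (metis sum_list_append)
  qed
  have set_sub: "set (drop i (take j xs)) \<subseteq> ?K" "set (drop i xs) \<subseteq> ?K" "set (take i xs) \<subseteq> ?K" for i j
    using xs(2) by (meson order_trans set_drop_subset set_take_subset)+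
  \<comment> \<open>Equal partial sums would cut out a shorter nonempty list whose sum is divisible
    by n.\<close>
  have "v i \<noteq> v j" if "i < j" "j < m" for i j
  proof
    assume "v i = v j"
    then have "[sum_list (take i xs) + 0 = sum_list (take i xs) + sum_list (drop i (take j xs))] (mod n)"
      using slice[of i j] that by (simp add: v_def cong_def)
    then have "n dvd sum_list (drop i (take j xs))"
      by (simp only: cong_add_lcancel_nat cong_sym_eq[of 0] cong_0_iff)
    then have "m \<le> length (drop i (take j xs))"
      unfolding m_def using that set_sub by (intro min) (auto simp: m_def)
    then show False using that by simp
  qed
  then have v_inj: "inj_on v {..<m}"
    by (auto simp: inj_on_def) (metis nat_neq_iff)
  define S where "S = v ` {..<m}"
  have S: "S \<subseteq> {..<n}" "S \<noteq> {}" "finite S" "card S = m"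
    using m v_inj by (auto simp: S_def v_def card_image)
  text \<open>A step from \<open>v i\<close> to any other \<open>v j\<close> would close up to a shorter zero-sum list.\<close>
  have step: "j = Suc i mod m" if "i < m" "j < m" "k \<in> ?K" "(v i + k) mod n = v j" for i j k
  proof (cases "j \<le> i")
    case True
    have "[sum_list (take j xs) + (sum_list (drop j (take i xs)) + k) = sum_list (take j xs) + 0] (mod n)"
      using that slice[OF True] by (simp add: v_def cong_def mod_simps flip: add.assoc)
    then have "n dvd sum_list (drop j (take i xs) @ [k])"
      by (simp only: cong_add_lcancel_nat cong_0_iff sum_list_append) simp
    then have "m \<le> length (drop j (take i xs) @ [k])"
      unfolding m_def using that set_sub by (intro min) auto
    then have "j = 0" "Suc i = m"
      using that True by (auto simp: m_def)
    then show ?thesis by simp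
  next
    case False
    have tot: "sum_list (take j xs) + sum_list (drop j xs) = sum_list xs"
      by (metis append_take_drop_id sum_list_append)
    have "[sum_list (take j xs) + (sum_list (drop j xs) + sum_list (take i xs) + k) =
        sum_list xs + sum_list (take j xs)] (mod n)"
    proof -
      have "[sum_list (take i xs) + k = sum_list (take j xs)] (mod n)"
        using that by (simp add: v_def cong_def mod_simps)
      then have "[sum_list xs + (sum_list (take i xs) + k) = sum_list xs + sum_list (take j xs)] (mod n)"
        by (simp only: cong_add_lcancel_nat)
      moreover have "sum_list xs + (sum_list (take i xs) + k) =
          sum_list (take j xs) + (sum_list (drop j xs) + sum_list (take i xs) + k)"
        using tot by linarith
      ultimately show ?thesis by (simp only:)
    qed
    also have "[sum_list xs + sum_list (take j xs) = 0 + sum_list (take j xs)] (mod n)"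
      using xs(3) by (intro cong_add) (auto simp: cong_0_iff)
    also have "0 + sum_list (take j xs) = sum_list (take j xs) + 0"
      by simp
    finally have "n dvd sum_list (drop j xs @ take i xs @ [k])"
      by (simp only: cong_add_lcancel_nat cong_0_iff sum_list_append) (simp add: add.assoc)
    then have "m \<le> length (drop j xs @ take i xs @ [k])"
      unfolding m_def using that set_sub by (intro min) auto
    then have "j = Suc i"
      using that False by (auto simp: m_def)
    then show ?thesis using that by simp
  qed
  have next_v: "(v i + xs ! i) mod n = v (Suc i mod m)" if "i < m" for i
  proof -
    have "sum_list (take (Suc i) xs) = sum_list (take i xs) + xs ! i"
      using that by (simp add: m_def take_Suc_conv_app_nth)
    then have *: "(v i + xs ! i) mod n = sum_list (take (Suc i) xs) mod n"
      by (simp add: v_def mod_simps)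
    show ?thesis
    proof (cases "Suc i = m")
      case True
      then have "sum_list (take (Suc i) xs) mod n = 0"
        using xs(3) by (simp add: m_def)
      then show ?thesis using * True by (simp add: v_def)
    next
      case False
      then show ?thesis using * that by (simp add: v_def)
    qed
  qed
  have xs_K: "xs ! i \<in> ?K" if "i < m" for i
    using xs(2) nth_mem[of i xs] that unfolding m_def by blast
  define w where "w = the_inv_into {..<m} v"
  have w: "w s < m" "v (w s) = s" if "s \<in> S" for s
    using that the_inv_into_into[OF v_inj, of s "{..<m}"] f_the_inv_into_f[OF v_inj, of s]
    by (auto simp: w_def S_def)
  have wv: "w (v i) = i" if "i < m" for i
    using that the_inv_into_f_f[OF v_inj] by (simp add: w_def)
  \<comment> \<open>The choice that follows the list: it leads from each partial sum to the next,
    and from the last back to the first because the whole sum is divisible by n.\<close>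
  define \<phi>0 where "\<phi>0 = restrict (\<lambda>s. xs ! w s) S"
  define G where "G = {\<phi> \<in> S \<rightarrow>\<^sub>E {..<n}.
    [(\<Sum>s\<in>S. q ^ ((s + \<phi> s) mod n)) = (\<Sum>s\<in>S. q ^ s)] (mod (q ^ n - 1))}"
  have \<phi>0_step: "(s + \<phi>0 s) mod n = v (Suc (w s) mod m)" if "s \<in> S" for s
    using next_v[of "w s"] w[OF that] that by (simp add: \<phi>0_def)
  have "\<phi>0 \<in> G"
  proof -
    have "\<phi>0 \<in> S \<rightarrow>\<^sub>E {..<n}"
      using xs_K w by (auto simp: \<phi>0_def)
    moreover have "(\<Sum>s\<in>S. q ^ ((s + \<phi>0 s) mod n)) = (\<Sum>s\<in>S. q ^ s)"
    proof -
      have "(\<Sum>s\<in>S. q ^ ((s + \<phi>0 s) mod n)) = (\<Sum>i<m. q ^ v (Suc i mod m))"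
        unfolding S_def sum.reindex[OF v_inj] o_def
        using \<phi>0_step wv by (intro sum.cong refl) (simp add: S_def)
      also have "\<dots> = (\<Sum>i<m. q ^ v i)"
        by (rule sum.reindex_bij_witness[of _ "\<lambda>i. if i = 0 then m - 1 else i - 1" "\<lambda>i. Suc i mod m"])
          (use m in \<open>auto simp: mod_Suc\<close>)
      also have "\<dots> = (\<Sum>s\<in>S. q ^ s)"
        unfolding S_def sum.reindex[OF v_inj] by simp
      finally show ?thesis .
    qed
    ultimately show ?thesis by (simp add: G_def)
  qed
  \<comment> \<open>A nonzero product uses only exponents with nonzero coefficients, and the
    congruence keeps every shifted residue inside \<open>S\<close>. Then \<open>step\<close> leaves
    the cyclic successor as the only target.\<close>
  have unique: "\<phi> = \<phi>0" if \<phi>: "\<phi> \<in> G" and nz: "(\<Prod>s\<in>S. a (\<phi> s) ^ (q ^ s)) \<noteq> 0" for \<phi>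
  proof (rule PiE_ext)
    show "\<phi> \<in> S \<rightarrow>\<^sub>E {..<n}" "\<phi>0 \<in> S \<rightarrow>\<^sub>E {..<n}"
      using \<phi> \<open>\<phi>0 \<in> G\<close> by (auto simp: G_def)
    fix s assume s: "s \<in> S"
    have \<phi>s: "\<phi> s \<in> ?K"
      using \<phi> s nz S q_ge_2 by (auto simp: G_def prod_zero_iff)
    have "(\<lambda>s. (s + \<phi> s) mod n) ` S \<subseteq> S"
      using \<phi> n_pos by (intro q_power_sum_cong_imp_subset S) (auto simp: G_def)
    then have "(s + \<phi> s) mod n \<in> S" using s by blast
    then obtain j where j: "j < m" "(s + \<phi> s) mod n = v j"
      by (auto simp: S_def)
    then have "j = Suc (w s) mod m"
      using step[of "w s" j "\<phi> s"] w[OF s] \<phi>s by simp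
    then have "[s + \<phi> s = s + \<phi>0 s] (mod n)"
      using j \<phi>0_step[OF s] by (simp add: cong_def)
    then have "[\<phi> s = \<phi>0 s] (mod n)"
      by (simp only: cong_add_lcancel_nat)
    moreover have "\<phi>0 s < n" using s xs_K w by (simp add: \<phi>0_def)
    ultimately show "\<phi> s = \<phi>0 s"
      using \<phi>s by (simp add: cong_def)
  qed
  let ?d = "\<Sum>s\<in>S. q ^ s"
  have "0 < ?d"
    using S q_ge_2 by (intro sum_pos) auto
  \<comment> \<open>Here \<open>m < n\<close> enters: some residue lies outside \<open>S\<close>, so
    the exponent omits a positive term of \<open>norm_exp\<close>.\<close>
  moreover have "?d < norm_exp"
  proof -
    have "S \<noteq> {..<n}" using S m by auto
    then obtain b where b: "b < n" "b \<notin> S" using S(1) by auto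
    have "?d < (\<Sum>s\<in>insert b S. q ^ s)"
      using b S q_ge_2 by simp
    also have "\<dots> \<le> (\<Sum>s<n. q ^ s)"
      using b S by (intro sum_mono2) auto
    finally show ?thesis by (simp add: norm_exp_def)
  qed
  ultimately have "(\<Sum>\<phi>\<in>G. \<Prod>s\<in>S. a (\<phi> s) ^ (q ^ s)) = 0"
    using vanish sum_linearized_quotient_power[OF f S(1)] unfolding G_def by simp
  moreover have "(\<Sum>\<phi>\<in>G. \<Prod>s\<in>S. a (\<phi> s) ^ (q ^ s)) = (\<Prod>s\<in>S. a (\<phi>0 s) ^ (q ^ s))"
  proof -
    have "finite G"
      using S unfolding G_def by (auto intro!: finite_PiE)
    then have "(\<Sum>\<phi>\<in>G. \<Prod>s\<in>S. a (\<phi> s) ^ (q ^ s)) = (\<Sum>\<phi>\<in>{\<phi>0}. \<Prod>s\<in>S. a (\<phi> s) ^ (q ^ s))"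
      using \<open>\<phi>0 \<in> G\<close> unique by (intro sum.mono_neutral_right) auto
    then show ?thesis by simp
  qed
  moreover have "(\<Prod>s\<in>S. a (\<phi>0 s) ^ (q ^ s)) \<noteq> 0"
    using S xs_K w by (simp add: prod_zero_iff \<phi>0_def)
  ultimately show False by simp
qed

lemma linearized_norm_one_quotients:
  fixes f :: "'a \<Rightarrow> 'a"
  assumes add: "\<And>x y. f (x + y) = f x + f y" and scale: "\<And>c x. f (h c * x) = h c * f x"
    and scattered: "\<And>x y. x \<noteq> 0 \<Longrightarrow> y \<noteq> 0 \<Longrightarrow> f y / y = f x / x \<Longrightarrow> y / x \<in> range h"
    and norm: "\<And>x. x \<noteq> 0 \<Longrightarrow> (f x / x) ^ norm_exp = 1"
  obtains b k where "b \<noteq> 0" "k < n" "gcd k n = 1" "\<And>x. f x = b * x ^ (q ^ k)"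
proof -
  obtain a where f: "\<And>x. f x = (\<Sum>i<n. a i * x ^ (q ^ i))"
    using ex_linearized_polynomial[OF add scale] by metis
  have fib: "card {x \<in> UNIV - {0}. f x / x = y} = q - 1" if "y \<in> (\<lambda>x. f x / x) ` (UNIV - {0})" for y
  proof -
    from that obtain x where x: "x \<noteq> 0" "y = f x / x" by blast
    show ?thesis
      unfolding x(2) by (rule card_fibre_projective) (use x scattered scale in auto)
  qed
  have vanish: "(\<Sum>x\<in>UNIV - {0}. (f x / x) ^ d) = 0" if "0 < d" "d < norm_exp" for d
  proof (rule sum_power_norm_one_image(2)[OF _ _ fib _ that])
    show "(f x / x) ^ norm_exp = 1" if "x \<in> UNIV - {0}" for x
      using norm that by simp
  qed (simp_all add: card_a)
  let ?K = "{i. i < n \<and> a i \<noteq> 0}"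
  define Z where "Z = {xs. xs \<noteq> [] \<and> set xs \<subseteq> ?K \<and> n dvd sum_list xs}"
  have long: "n \<le> length xs" if "xs \<in> Z" for xs
  proof -
    obtain ys where ys: "ys \<in> Z" "\<And>zs. zs \<in> Z \<Longrightarrow> length ys \<le> length zs"
      using ex_has_least_nat[of "\<lambda>xs. xs \<in> Z" xs length] \<open>xs \<in> Z\<close> by blast
    have "n \<le> length ys"
      by (rule min_zero_sum_list_length[OF f vanish]) (use ys in \<open>auto simp: Z_def\<close>)
    then show ?thesis using ys(2)[OF that] by simp
  qed
  have "f 1 \<noteq> 0"
    using norm[of 1] norm_exp_pos by (auto simp: power_0_left)
  then obtain k where k: "k \<in> ?K"
    unfolding f by (metis (mono_tags, lifting) lessThan_iff mem_Collect_eq mult_zero_left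
        sum.not_neutral_contains_not_neutral)
  \<comment> \<open>Repeating \<open>k\<close> only n/gcd(k, n) times already gives a sum divisible
    by n, so the length bound forces the gcd to be 1.\<close>
  have gcd: "gcd k n = 1"
  proof -
    let ?g = "gcd k n"
    obtain k' n' where kn: "k = ?g * k'" "n = ?g * n'"
      by (meson dvdE gcd_dvd1 gcd_dvd2)
    have "n' > 0" "?g > 0" using kn n_pos by (auto intro: Nat.gr0I)
    have "n' * k = n * k'"
      using kn by (metis mult.assoc mult.commute)
    then have "replicate n' k \<in> Z"
      using k \<open>n' > 0\<close> by (auto simp: Z_def sum_list_replicate)
    then have "?g * n' \<le> n'" using long[of "replicate n' k"] kn(2) by simp
    then have "?g \<le> 1" using \<open>n' > 0\<close> by simp
    then show ?thesis using \<open>?g > 0\<close> by linarith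
  qed
  \<comment> \<open>As \<open>k\<close> is invertible modulo n, l is congruent to j k. Then l
    followed by n - j copies of \<open>k\<close> is a zero-sum list of length n - j + 1, whence j is
    0 or 1. For j = 1 the two exponents agree; j = 0 makes the list [0] admissible, which forces n =
    1.\<close>
  have K: "l = k" if l: "l \<in> ?K" for l
  proof -
    obtain x where "[k * x = 1] (mod n)"
      using cong_solve_coprime_nat[of k n] gcd by (auto simp: coprime_iff_gcd_eq_1)
    then have "[l * (k * x) = l * 1] (mod n)"
      by (intro cong_mult) auto
    define j where "j = (l * x) mod n"
    have j: "[j * k = l] (mod n)"
      using \<open>[l * (k * x) = l * 1] (mod n)\<close> by (simp add: j_def cong_def mod_simps ac_simps)
    have "j < n" using n_pos by (simp add: j_def)
    have "[l + (n - j) * k = j * k + (n - j) * k] (mod n)"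
      using j by (intro cong_add) (auto simp: cong_sym)
    also have "j * k + (n - j) * k = n * k"
      using \<open>j < n\<close> by (simp flip: add_mult_distrib)
    finally have "n dvd l + (n - j) * k"
      by (simp add: cong_dvd_iff)
    then have "l # replicate (n - j) k \<in> Z"
      using k l by (auto simp: Z_def sum_list_replicate)
    then have "n \<le> Suc (n - j)"
      using long by force
    then consider "j = 1" | "j = 0" using \<open>j < n\<close> by linarith
    then show ?thesis
    proof cases
      case 1
      then show ?thesis using j k l by (simp add: cong_def)
    next
      case 2
      then have "l = 0" using j l by (simp add: cong_def)
      then have "[l] \<in> Z" using l by (simp add: Z_def)
      then have "n \<le> 1" using long by force
      then show ?thesis using k l by auto
    qed
  qed
  have "f x = a k * x ^ (q ^ k)" for x
  proof -
    have "a i = 0" if "i \<in> {..<n} - {k}" for i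
      using that K by blast
    then have "f x = (\<Sum>i\<in>{k}. a i * x ^ (q ^ i))"
      unfolding f using k by (intro sum.mono_neutral_right) simp_all
    then show ?thesis by simp
  qed
  then show thesis
    using that[of "a k" k] k gcd by auto
qed

subsection \<open>Scattered subspaces and long lines\<close>

lemma fq_subspace_iff:
  "fq_subspace h U \<longleftrightarrow> 0 \<in> U \<and> (\<forall>u\<in>U. \<forall>v\<in>U. u + v \<in> U) \<and> (\<forall>c. \<forall>u\<in>U. h c *s u \<in> U)"
proof -
  interpret vector_space "fq_scale h :: 'k \<Rightarrow> 'a ^ 'd \<Rightarrow> 'a ^ 'd"
    by (rule vector_space_fq_scale[OF field_hom])
  show ?thesis
    unfolding fq_subspace_def subspace_def fq_scale_def by simp
qed

lemma fq_subspace_diff: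
  assumes "fq_subspace h U" "u \<in> U" "v \<in> U"
  shows "u - v \<in> U"
proof -
  have "h (- 1) *s v \<in> U" using assms by (auto simp: fq_subspace_iff)
  then have "u + h (- 1) *s v \<in> U" using assms by (auto simp: fq_subspace_iff)
  then show ?thesis by (simp add: h_minus)
qed

lemma fq_subspace_Int_vec:
  assumes "fq_subspace h U" "vec.subspace W"
  shows "fq_subspace h (W \<inter> U)"
  using assms by (auto simp: fq_subspace_iff vec.subspace_def)

lemma fq_dim_eq_iff:
  assumes "fq_subspace h (U :: ('a ^ 'd) set)"
  shows "fq_dim h U = d \<longleftrightarrow> card U = q ^ d"
proof -
  interpret vector_space "fq_scale h :: 'k \<Rightarrow> 'a ^ 'd \<Rightarrow> 'a ^ 'd"
    by (rule vector_space_fq_scale[OF field_hom])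
  have "card U = q ^ fq_dim h U"
    using card_subspace[of U] assms unfolding fq_subspace_def fq_dim_def card_k by simp
  then show ?thesis
    using q_ge_2 by simp
qed

lemma weight_eq_iff:
  assumes "fq_subspace h U" "vec.subspace W"
  shows "weight h U W = d \<longleftrightarrow> card (W \<inter> U) = q ^ d"
  using fq_dim_eq_iff[OF fq_subspace_Int_vec[OF assms]] by (simp add: weight_def)

lemma vec_dim_eq_iff:
  assumes "vec.subspace (W :: ('a ^ 'd) set)"
  shows "vec.dim W = d \<longleftrightarrow> card W = q ^ (n * d)"
proof -
  have "card W = q ^ (n * vec.dim W)"
    using vec.card_subspace[OF assms] by (simp add: card_a power_mult)
  then show ?thesis
    using q_ge_2 n_pos by simp
qed

text \<open>A point spanned by u in U always contains the q multiples of u by F_q; weight 1 says by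
  counting that it contains no other vector of U.\<close>

lemma scattered_iff:
  "scattered h U \<longleftrightarrow> fq_subspace h U \<and> (\<forall>u\<in>U. \<forall>c. u \<noteq> 0 \<longrightarrow> c *s u \<in> U \<longrightarrow> c \<in> range h)"
proof -
  have "weight h U (vec.span {u}) = 1 \<longleftrightarrow> (\<forall>c. c *s u \<in> U \<longrightarrow> c \<in> range h)"
    if U: "fq_subspace h U" and u: "u \<in> U" "u \<noteq> 0" for u
  proof -
    have sub: "(\<lambda>c. h c *s u) ` UNIV \<subseteq> vec.span {u} \<inter> U"
      using U u by (auto simp: fq_subspace_iff vec.span_singleton)
    have inj: "c = d" if "c *s u = d *s u" for c d
      using that u vec.scale_right_imp_eq by blast
    have card: "card ((\<lambda>c. h c *s u) ` UNIV) = q"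
      using inj inj_h card_k by (subst card_image) (auto simp: inj_on_def)
    have "weight h U (vec.span {u}) = 1 \<longleftrightarrow> card (vec.span {u} \<inter> U) = q"
      by (simp add: weight_eq_iff[OF U])
    also have "\<dots> \<longleftrightarrow> vec.span {u} \<inter> U = (\<lambda>c. h c *s u) ` UNIV"
    proof
      assume "card (vec.span {u} \<inter> U) = q"
      then have "card ((\<lambda>c. h c *s u) ` UNIV) = card (vec.span {u} \<inter> U)"
        by (simp only: card)
      from card_subset_eq[OF finite sub this]
      show "vec.span {u} \<inter> U = (\<lambda>c. h c *s u) ` UNIV"
        by (rule sym)
    qed (simp only: card)
    also have "\<dots> \<longleftrightarrow> (\<forall>c. c *s u \<in> U \<longrightarrow> c \<in> range h)"
    proof
      assume eq: "vec.span {u} \<inter> U = (\<lambda>c. h c *s u) ` UNIV"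
      show "\<forall>c. c *s u \<in> U \<longrightarrow> c \<in> range h"
      proof (intro allI impI)
        fix c assume "c *s u \<in> U"
        then have "c *s u \<in> vec.span {u} \<inter> U"
          unfolding vec.span_singleton by blast
        then obtain d where "c *s u = h d *s u" unfolding eq by blast
        then show "c \<in> range h" using inj by blast
      qed
    next
      assume "\<forall>c. c *s u \<in> U \<longrightarrow> c \<in> range h"
      then have "vec.span {u} \<inter> U \<subseteq> (\<lambda>c. h c *s u) ` UNIV"
        unfolding vec.span_singleton by blast
      then show "vec.span {u} \<inter> U = (\<lambda>c. h c *s u) ` UNIV"
        using sub by blast
    qed
    finally show ?thesis .
  qed
  then show ?thesis
    unfolding scattered_def linear_set_def by auto
qed

lemma max_scattered_4_iff:
  fixes U :: "('a ^ 4) set"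
  shows "max_scattered h n U \<longleftrightarrow> scattered h U \<and> card U = q ^ (2 * n)"
proof -
  have "2 * fq_dim h U = CARD(4) * n \<longleftrightarrow> fq_dim h U = 2 * n"
    by auto
  then show ?thesis
    unfolding max_scattered_def using fq_dim_eq_iff[of U "2 * n"] by (auto simp: scattered_def)
qed

lemma long_line_iff:
  assumes "fq_subspace h U"
  shows "long_line h n U W \<longleftrightarrow> pg_line W \<and> card (W \<inter> U) = q ^ n"
  using weight_eq_iff[OF assms] by (auto simp: long_line_def pg_line_def)

lemma pg_line_iff_card: "pg_line W \<longleftrightarrow> vec.subspace (W :: ('a ^ 'd) set) \<and> card W = q ^ (2 * n)"
  using vec_dim_eq_iff[of W 2] by (auto simp: pg_line_def mult.commute)

end

section \<open>Points and lines as linear subspaces\<close>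

lemma pg_point_iff: "pg_point P \<longleftrightarrow> (\<exists>u. u \<noteq> 0 \<and> P = vec.span {u})"
proof
  assume P: "pg_point P"
  then have "vec.subspace P" "vec.dim P = 1" by (auto simp: pg_point_def)
  then obtain B where B: "B \<subseteq> P" "vec.independent B" "P \<subseteq> vec.span B" "card B = 1"
    using vec.basis_exists by metis
  then obtain u where u: "B = {u}" by (auto simp: card_1_singleton_iff)
  have "vec.span B \<subseteq> P"
    using B \<open>vec.subspace P\<close> by (simp add: vec.span_minimal)
  then show "\<exists>u. u \<noteq> 0 \<and> P = vec.span {u}"
    using B u by auto
next
  assume "\<exists>u. u \<noteq> 0 \<and> P = vec.span {u}"
  then show "pg_point P" by (auto simp: pg_point_def)
qed

lemma span_singleton_in_points_of:
  assumes "vec.subspace W"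
  shows "u \<noteq> 0 \<Longrightarrow> vec.span {u} \<in> points_of W \<longleftrightarrow> u \<in> W"
  using assms vec.span_base[of u "{u}"] vec.span_minimal[of "{u}" W]
  by (auto simp: points_of_def pg_point_iff)

lemma points_of_disjoint_iff:
  assumes "vec.subspace W" "vec.subspace W'"
  shows "points_of W \<inter> points_of W' = {} \<longleftrightarrow> W \<inter> W' = {0}"
proof
  assume L: "points_of W \<inter> points_of W' = {}"
  have "u = 0" if "u \<in> W" "u \<in> W'" for u
    using that L span_singleton_in_points_of[of W u] span_singleton_in_points_of[of W' u] assms by blast
  then show "W \<inter> W' = {0}"
    using assms by (auto simp: vec.subspace_0)
next
  assume R: "W \<inter> W' = {0}"
  have "u \<in> W \<inter> W'" if "vec.span {u} \<subseteq> W" "vec.span {u} \<subseteq> W'" for u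
    using that vec.span_base[of u "{u}"] by auto
  then show "points_of W \<inter> points_of W' = {}"
    using R by (auto simp: points_of_def pg_point_iff)
qed

lemma linear_set_Int_points_of:
  assumes "vec.subspace W"
  shows "linear_set U \<inter> points_of W = linear_set (W \<inter> U)"
  using span_singleton_in_points_of[OF assms] by (auto simp: linear_set_def)

lemma linear_set_empty_iff: "linear_set U = {} \<longleftrightarrow> U \<subseteq> {0}"
  by (auto simp: linear_set_def)

lemma pg_line_eq_span:
  assumes "pg_line W" "u \<in> W" "v \<in> W" "u \<noteq> 0" "v \<notin> vec.span {u}"
  shows "W = vec.span {v, u}"
proof -
  have "v \<noteq> u" using assms vec.span_base by blast
  have "vec.independent {v, u}"
    using assms by (simp add: vec.independent_insert)
  moreover have "card {v, u} = vec.dim W"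
    using assms \<open>v \<noteq> u\<close> by (simp add: pg_line_def)
  ultimately have "W \<subseteq> vec.span {v, u}"
    using assms vec.card_eq_dim[of "{v, u}" W] by auto
  moreover have "vec.span {v, u} \<subseteq> W"
    using assms by (intro vec.span_minimal) (auto simp: pg_line_def)
  ultimately show ?thesis by auto
qed

lemma pg_lines_eqI:
  assumes "pg_line W" "pg_line W'" "W \<subseteq> W'"
  shows "W = W'"
  using assms by (intro vec.subspace_dim_equal) (auto simp: pg_line_def)

lemma span_pair: "vec.span {u, v} = {a *s u + b *s v | a b. True}"
proof -
  have "\<exists>a b. x = a *s u + b *s v" if "x - k *s u = b *s v" for x k b
    using that by (metis add.commute diff_add_cancel)
  moreover have "\<exists>k b'. a *s u + b *s v - k *s u = b' *s v" for a b
    by (rule exI[of _ a]) auto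
  ultimately show ?thesis
    by (auto simp: vec.span_insert[of u] vec.span_singleton image_iff)
qed

section \<open>Long lines of a scattered subspace\<close>

context finite_field_extension
begin

lemma ex_not_in_range_h:
  assumes "n \<ge> 2"
  shows "\<exists>c. c \<notin> range h"
proof (rule ccontr)
  assume "\<not> ?thesis"
  then have "range h = UNIV" by auto
  then have "q ^ n = q ^ 1" using card_range_h card_a by simp
  then show False using q_ge_2 assms by (subst (asm) power_inject_exp) auto
qed

text \<open>The map (u, u') -> c u - u' is injective on pairs from \<open>W \<inter> U\<close>,
  since otherwise c would carry a nonzero vector of U into U. There are q^{2n} pairs, as many as
  vectors of W.\<close>

lemma long_line_differences:
  assumes U: "scattered h U" and W: "long_line h n U W" and c: "c \<notin> range h" and p: "p \<in> W"
  shows "\<exists>u\<in>W \<inter> U. \<exists>u'\<in>W \<inter> U. p = c *s u - u'"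
proof -
  have fq: "fq_subspace h U" using U by (simp add: scattered_iff)
  have line: "pg_line W" and card_WU: "card (W \<inter> U) = q ^ n"
    using W long_line_iff[OF fq] by auto
  then have sub: "vec.subspace W" and card_W: "card W = q ^ (2 * n)"
    using pg_line_iff_card by auto
  let ?D = "(W \<inter> U) \<times> (W \<inter> U)" and ?g = "\<lambda>(u, u'). c *s u - u'"
  have "inj_on ?g ?D"
  proof (rule inj_onI, clarify)
    fix u u' v v'
    assume *: "u \<in> U" "u' \<in> U" "v \<in> U" "v' \<in> U" and eq: "c *s u - u' = c *s v - v'"
    have "c *s (u - v) = u' - v'"
      using eq by (simp add: vec.scale_right_diff_distrib algebra_simps)
    then have "c *s (u - v) \<in> U"
      using fq_subspace_diff[OF fq] * by simp
    then have "u - v = 0"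
      using U c fq_subspace_diff[OF fq] * unfolding scattered_iff by blast
    then show "u = v \<and> u' = v'" using eq by simp
  qed
  then have "card (?g ` ?D) = card W"
    by (simp add: card_image card_cartesian_product card_WU card_W mult_2 power_add)
  moreover have "?g ` ?D \<subseteq> W"
    using sub by (auto intro: vec.subspace_diff vec.subspace_scale)
  ultimately have "?g ` ?D = W"
    by (intro card_subset_eq) auto
  then have "p \<in> ?g ` ?D" using p by simp
  then obtain u u' where "u \<in> W \<inter> U" "u' \<in> W \<inter> U" "p = c *s u - u'"
    by (elim imageE SigmaE2 SigmaE) simp
  then show ?thesis by blast
qed

lemma long_lines_disjoint:
  assumes n: "n \<ge> 3" and U: "scattered h U"
    and W: "long_line h n U W" and W': "long_line h n U W'" and "W \<noteq> W'"
  shows "W \<inter> W' = {0}"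
proof (rule ccontr)
  assume nd: "W \<inter> W' \<noteq> {0}"
  have lines: "pg_line W" "pg_line W'" and sub: "vec.subspace W" "vec.subspace W'"
    using W W' by (auto simp: long_line_def pg_line_def)
  then obtain p where p: "p \<in> W" "p \<in> W'" "p \<noteq> 0"
    using nd vec.subspace_0 by blast
  have fq: "fq_subspace h U" using U by (simp add: scattered_iff)
  have multiple: "\<exists>k. y = k *s x" if "x \<in> W" "x \<in> W'" "x \<noteq> 0" "y \<in> W" "y \<in> W'" for x y
  proof -
    have "y \<in> vec.span {x}"
      using that pg_line_eq_span[OF lines(1), of x y] pg_line_eq_span[OF lines(2), of x y] \<open>W \<noteq> W'\<close>
      by metis
    then show ?thesis unfolding vec.span_singleton by blast
  qed
  define D where "D = W \<inter> W' \<inter> U"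
  \<comment> \<open>All vectors of \<open>D\<close> lie on one common point of the two lines, and
    its weight is at most 1.\<close>
  have "card D \<le> q"
  proof (cases "D \<subseteq> {0}")
    case True
    then have "card D \<le> card {0 :: 'a ^ 'b}" by (intro card_mono) auto
    then show ?thesis using q_ge_2 by simp
  next
    case False
    then obtain x where x: "x \<in> D" "x \<noteq> 0" by auto
    have "D \<subseteq> (\<lambda>c. h c *s x) ` UNIV"
    proof
      fix y assume y: "y \<in> D"
      then obtain k where k: "y = k *s x"
        using x multiple unfolding D_def by blast
      then have "k \<in> range h"
        using x y U unfolding D_def scattered_iff by blast
      then show "y \<in> (\<lambda>c. h c *s x) ` UNIV"
        using k by auto
    qed
    then have "card D \<le> card ((\<lambda>c. h c *s x) ` UNIV)"
      by (intro card_mono) auto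
    also have "\<dots> \<le> q"
      using card_image_le[of UNIV "\<lambda>c. h c *s x"] card_k by simp
    finally show ?thesis .
  qed
  obtain c where c: "c \<notin> range h"
    using ex_not_in_range_h n by auto
  have "range (\<lambda>k. k *s p) \<subseteq> (\<lambda>(u, u'). c *s u - u') ` (D \<times> D)"
  proof clarify
    fix k
    \<comment> \<open>Taking the negative on the second line lets the two representations be added
      to zero. The sum puts c (u + v) into U, so u + v = 0 and both \<open>u\<close> and
      \<open>u'\<close> lie on both lines.\<close>
    have kp: "k *s p \<in> W" "- (k *s p) \<in> W'"
      using p sub by (auto intro: vec.subspace_scale vec.subspace_neg)
    obtain u u' where u: "u \<in> W \<inter> U" "u' \<in> W \<inter> U" "k *s p = c *s u - u'"
      using long_line_differences[OF U W c kp(1)] by blast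
    obtain v v' where v: "v \<in> W' \<inter> U" "v' \<in> W' \<inter> U" "- (k *s p) = c *s v - v'"
      using long_line_differences[OF U W' c kp(2)] by blast
    have "c *s (u + v) - (u' + v') = (c *s u - u') + (c *s v - v')"
      by (simp add: vec.scale_right_distrib)
    also have "\<dots> = 0"
      unfolding u(3)[symmetric] v(3)[symmetric] by simp
    finally have eq: "c *s (u + v) = u' + v'" by simp
    then have "c *s (u + v) \<in> U"
      using fq u v by (auto simp: fq_subspace_iff)
    moreover have "u + v \<in> U"
      using fq u v by (auto simp: fq_subspace_iff)
    ultimately have "u + v = 0"
      using U c unfolding scattered_iff by blast
    then have "u' + v' = 0" using eq by simp
    have "u = - v" "u' = - v'"
      using \<open>u + v = 0\<close> \<open>u' + v' = 0\<close> by (simp_all add: eq_neg_iff_add_eq_0)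
    then have "u \<in> W'" "u' \<in> W'"
      using v sub by (auto intro: vec.subspace_neg)
    then show "k *s p \<in> (\<lambda>(u, u'). c *s u - u') ` (D \<times> D)"
      using u by (intro image_eqI[of _ _ "(u, u')"]) (auto simp: D_def)
  qed
  then have "card (range (\<lambda>k. k *s p)) \<le> card (D \<times> D)"
    by (intro surj_card_le) auto
  also have "\<dots> \<le> q * q"
    unfolding card_cartesian_product using \<open>card D \<le> q\<close> by (intro mult_mono) auto
  finally have "card (range (\<lambda>k. k *s p)) \<le> q ^ 2"
    by (simp add: power2_eq_square)
  moreover have "card (range (\<lambda>k. k *s p)) = q ^ n"
    using p(3) card_a by (subst card_image) (auto simp: inj_on_def)
  ultimately show False
    using q_ge_2 n power_increasing_iff[of q n 2] by simp
qed

text \<open>The sum of the two parts is direct because the lines meet trivially, and it already has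
  q^n q^n = \<open>card U\<close> elements.\<close>

lemma scattered_eq_sum_of_long_lines:
  assumes U: "fq_subspace h U" "card U = q ^ (2 * n)"
    and W: "card (W \<inter> U) = q ^ n" "card (W' \<inter> U) = q ^ n"
    and sub: "vec.subspace W" "vec.subspace W'" and "W \<inter> W' = {0}"
  shows "U = {u + u' | u u'. u \<in> W \<inter> U \<and> u' \<in> W' \<inter> U}"
proof -
  let ?g = "\<lambda>(u, u'). u + u'"
  have "inj_on ?g ((W \<inter> U) \<times> (W' \<inter> U))"
  proof (rule inj_onI, clarify)
    fix u u' v v' assume *: "u \<in> W" "v \<in> W" "u' \<in> W'" "v' \<in> W'" and "u + u' = v + v'"
    then have eq: "u - v = v' - u'" by (simp add: algebra_simps)
    have "u - v \<in> W" "v' - u' \<in> W'"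
      using * sub by (auto intro: vec.subspace_diff)
    then have "u - v \<in> W \<inter> W'"
      using eq by (metis IntI)
    then have "u - v = 0"
      using \<open>W \<inter> W' = {0}\<close> by blast
    then show "u = v \<and> u' = v'" using eq by simp
  qed
  then have "card (?g ` ((W \<inter> U) \<times> (W' \<inter> U))) = card U"
    by (simp add: card_image card_cartesian_product W U mult_2 power_add)
  moreover have "?g ` ((W \<inter> U) \<times> (W' \<inter> U)) \<subseteq> U"
    using U by (auto simp: fq_subspace_iff)
  ultimately have "U = ?g ` ((W \<inter> U) \<times> (W' \<inter> U))"
    by (intro card_subset_eq[symmetric]) auto
  also have "\<dots> = {u + u' | u u'. u \<in> W \<inter> U \<and> u' \<in> W' \<inter> U}"
    by force
  finally show ?thesis .
qed

subsection \<open>Two lines of pseudoregulus type\<close>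

text \<open>The hypothesis describes only the points of the linear set on \<open>r\<close>, so the
  vectors of \<open>U\<close> must be recovered: \<open>r \<inter> U\<close> is a graph over its
  first coordinates, counting shows that these fill the field, and the quotients have norm 1 up to
  the scalar \<open>\<rho>\<close>.\<close>

lemma long_line_of_pseudoregulus_type:
  fixes U :: "('a ^ 'd) set"
  assumes U: "scattered h U" and r: "line_of_pseudoregulus_type h (linear_set U) r"
  obtains w v k where "pg_line r" "w \<in> r" "v \<in> r" "\<And>a b. a *s w + b *s v = 0 \<Longrightarrow> a = 0 \<and> b = 0"
    "k < n" "gcd k n = 1" "r \<inter> U = {x *s w + x ^ (q ^ k) *s v | x. True}"
proof -
  have line: "pg_line r" and sub: "vec.subspace r"
    using r by (auto simp: line_of_pseudoregulus_type_def pg_line_def)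
  have fq: "fq_subspace h U" using U by (simp add: scattered_iff)
  have fq_r: "fq_subspace h (r \<inter> U)"
    by (rule fq_subspace_Int_vec[OF fq sub])
  obtain w v \<rho> \<tau> where wv: "w \<in> r" "v \<in> r" "w \<noteq> v" "vec.independent {w, v}" and "\<rho> \<noteq> 0"
    and \<tau>: "field_aut \<tau>" "{x. \<tau> x = x} = range h"
    and L: "linear_set (r \<inter> U) = {vec.span {c *s w + (\<rho> * \<tau> c) *s v} | c. c \<noteq> 0}"
    using r unfolding line_of_pseudoregulus_type_def pseudoregulus_type_on_line_def
      linear_set_Int_points_of[OF sub] by blast
  have \<tau>_mult: "\<tau> (x * y) = \<tau> x * \<tau> y" and \<tau>_1: "\<tau> 1 = 1" for x y
    using \<tau> by (auto simp: field_aut_def field_hom_def)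
  have \<tau>_h: "\<tau> (h c) = h c" for c
    using \<tau>(2) by blast
  have \<tau>_nz: "\<tau> c \<noteq> 0" if "c \<noteq> 0" for c
    using \<tau>_mult[of c "inverse c"] \<tau>_1 that by auto
  have v0: "v \<noteq> 0" and w_notin: "w \<notin> vec.span {v}"
    using wv by (auto simp: vec.independent_insert)
  have indep: "a = 0 \<and> b = 0" if "a *s w + b *s v = 0" for a b
  proof -
    have "a = 0"
    proof (rule ccontr)
      assume "a \<noteq> 0"
      have "a *s w = (- b) *s v"
        using that by (simp add: eq_neg_iff_add_eq_0)
      then have "inverse a *s (a *s w) = (inverse a * (- b)) *s v"
        by simp
      then have "w = (inverse a * (- b)) *s v"
        using \<open>a \<noteq> 0\<close> by simp
      then show False using w_notin unfolding vec.span_singleton by blast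
    qed
    then show ?thesis using that v0 by simp
  qed
  have coord_eq: "a = a' \<and> b = b'" if "a *s w + b *s v = a' *s w + b' *s v" for a b a' b'
  proof -
    have "(a - a') *s w + (b - b') *s v = 0"
      using that by (simp add: vec.scale_left_diff_distrib algebra_simps)
    then show ?thesis using indep by fastforce
  qed
  \<comment> \<open>The norm of c lies in F_q and is fixed by \<open>\<tau>\<close>, so \<tau>(c)
    has the same norm as c.\<close>
  have \<tau>_norm: "(\<tau> c / c) ^ norm_exp = 1" if "c \<noteq> 0" for c
  proof -
    have "\<tau> c ^ i = \<tau> (c ^ i)" for i
      by (induction i) (simp_all add: \<tau>_mult \<tau>_1)
    moreover have "\<tau> (c ^ norm_exp) = c ^ norm_exp"
      using power_norm_exp_in_range[of c] \<tau>_h by auto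
    ultimately show ?thesis using that by (simp add: power_divide)
  qed
  define X where "X = {x. \<exists>y. x *s w + y *s v \<in> U}"
  have in_r: "a *s w + b *s v \<in> r" for a b
    using wv sub by (intro vec.subspace_add vec.subspace_scale)
  \<comment> \<open>The quotient of the two coordinates depends only on the point spanned by u, so
    it can be read off from the given parametrization; \<open>point\<close> is the converse.\<close>
  have elem: "\<exists>x y c. u = x *s w + y *s v \<and> x \<noteq> 0 \<and> c \<noteq> 0 \<and> y / (\<rho> * x) = \<tau> c / c"
    if u: "u \<in> U" "u \<in> r" "u \<noteq> 0" for u
  proof -
    have "vec.span {u} \<in> linear_set (r \<inter> U)"
      using u by (auto simp: linear_set_def)
    then obtain c where c: "c \<noteq> 0" "vec.span {u} = vec.span {c *s w + (\<rho> * \<tau> c) *s v}"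
      unfolding L by blast
    then have "u \<in> vec.span {c *s w + (\<rho> * \<tau> c) *s v}"
      using vec.span_base[of u "{u}"] by simp
    then obtain l where l: "u = l *s (c *s w + (\<rho> * \<tau> c) *s v)"
      unfolding vec.span_singleton by blast
    then have "l \<noteq> 0" using u by auto
    then have "(l * \<rho> * \<tau> c) / (\<rho> * (l * c)) = \<tau> c / c"
      using \<open>\<rho> \<noteq> 0\<close> by simp
    moreover have "u = (l * c) *s w + (l * \<rho> * \<tau> c) *s v"
      unfolding l by (simp add: vec.scale_right_distrib mult.assoc)
    ultimately show ?thesis
      using \<open>l \<noteq> 0\<close> c(1) by (metis no_zero_divisors)
  qed
  have point: "\<exists>x y. x *s w + y *s v \<in> U \<and> x \<noteq> 0 \<and> y / (\<rho> * x) = \<tau> c / c" if "c \<noteq> 0" for c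
  proof -
    let ?p = "c *s w + (\<rho> * \<tau> c) *s v"
    have "vec.span {?p} \<in> linear_set (r \<inter> U)"
      unfolding L using that by blast
    then obtain u where u: "u \<in> r \<inter> U" "u \<noteq> 0" "vec.span {?p} = vec.span {u}"
      unfolding linear_set_def by blast
    then have "u \<in> vec.span {?p}"
      using vec.span_base[of u "{u}"] by simp
    then obtain l where l: "u = l *s ?p"
      unfolding vec.span_singleton by blast
    then have "l \<noteq> 0" using u by auto
    moreover have "u = (l * c) *s w + (l * \<rho> * \<tau> c) *s v"
      unfolding l by (simp add: vec.scale_right_distrib mult.assoc)
    ultimately show ?thesis
      using u \<open>\<rho> \<noteq> 0\<close> that by (intro exI[of _ "l * c"] exI[of _ "l * \<rho> * \<tau> c"]) auto
  qed
  \<comment> \<open>No point of the parametrization has first coordinate 0, so two vectors of U on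
    \<open>r\<close> with equal first coordinates coincide.\<close>
  have X_0: "y = 0" if yU: "0 *s w + y *s v \<in> U" for y
  proof (rule ccontr)
    assume "y \<noteq> 0"
    then have "0 *s w + y *s v \<noteq> 0" using v0 by simp
    then obtain x' y' where "0 *s w + y *s v = x' *s w + y' *s v" "x' \<noteq> 0"
      using elem[OF yU in_r] by blast
    then show False using coord_eq by metis
  qed
  define f where "f = (\<lambda>x. SOME y. x *s w + y *s v \<in> U)"
  have f: "x *s w + f x *s v \<in> U" if "x \<in> X" for x
    unfolding f_def by (rule someI_ex) (use that in \<open>simp add: X_def\<close>)
  have f_eq: "y = f x" if "x *s w + y *s v \<in> U" for x y
  proof -
    have "x *s w + f x *s v \<in> U" using f that X_def by blast
    then have "(x *s w + y *s v) - (x *s w + f x *s v) \<in> U"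
      by (rule fq_subspace_diff[OF fq that])
    then have "0 *s w + (y - f x) *s v \<in> U"
      by (simp add: vec.scale_left_diff_distrib)
    then show ?thesis using X_0 by fastforce
  qed
  have X_scale: "h c * x \<in> X" "f (h c * x) = h c * f x" if "x \<in> X" for c x
  proof -
    have "h c *s (x *s w + f x *s v) \<in> U"
      using fq f[OF that] unfolding fq_subspace_iff by blast
    then have *: "(h c * x) *s w + (h c * f x) *s v \<in> U"
      by (simp add: vec.scale_right_distrib)
    then show "h c * x \<in> X" by (auto simp: X_def)
    show "f (h c * x) = h c * f x" using f_eq[OF *] by simp
  qed
  \<comment> \<open>Equal quotients make the two vectors of U proportional, and the scattered
    property puts the factor into F_q.\<close>
  have ratio: "y / x \<in> range h" if "x \<in> X" "y \<in> X" "x \<noteq> 0" "y \<noteq> 0" "f y / y = f x / x" for x y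
  proof -
    have "y / x * f x = f y" using that(3-5) by (simp add: field_simps)
    moreover have "(y / x) *s (x *s w + f x *s v) = (y / x * x) *s w + (y / x * f x) *s v"
      by (simp only: vec.scale_right_distrib vec.scale_scale)
    ultimately have "(y / x) *s (x *s w + f x *s v) = y *s w + f y *s v"
      using that(3) by simp
    then have "(y / x) *s (x *s w + f x *s v) \<in> U"
      using f[OF that(2)] by (simp only:)
    moreover have "x *s w + f x *s v \<noteq> 0" using indep that by blast
    ultimately show ?thesis
      using U f[OF that(1)] unfolding scattered_iff by blast
  qed
  let ?S = "X - {0}" and ?g = "\<lambda>x. f x / (\<rho> * x)" and ?t = "\<lambda>c. \<tau> c / c"
  have im: "?g ` ?S = ?t ` (UNIV - {0})"
  proof
    show "?g ` ?S \<subseteq> ?t ` (UNIV - {0})"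
    proof
      fix z assume "z \<in> ?g ` ?S"
      then obtain x where x: "x \<in> X" "x \<noteq> 0" "z = f x / (\<rho> * x)" by blast
      then have "x *s w + f x *s v \<noteq> 0" using indep by blast
      then obtain x' y' c where *: "x *s w + f x *s v = x' *s w + y' *s v" "c \<noteq> 0"
          "y' / (\<rho> * x') = \<tau> c / c"
        using elem[OF f[OF x(1)] in_r] by blast
      then have "f x / (\<rho> * x) = \<tau> c / c" using coord_eq by metis
      then show "z \<in> ?t ` (UNIV - {0})" using *(2) x(3) by blast
    qed
    show "?t ` (UNIV - {0}) \<subseteq> ?g ` ?S"
    proof
      fix z assume "z \<in> ?t ` (UNIV - {0})"
      then obtain c where c: "c \<noteq> 0" "z = \<tau> c / c" by blast
      then obtain x y where xy: "x *s w + y *s v \<in> U" "x \<noteq> 0" "y / (\<rho> * x) = \<tau> c / c"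
        using point by blast
      then have "x \<in> ?S" by (auto simp: X_def)
      then show "z \<in> ?g ` ?S"
        using c xy f_eq[OF xy(1)] by (intro image_eqI[of _ _ x]) auto
    qed
  qed
  have fib_t: "card {c \<in> UNIV - {0}. ?t c = y} = q - 1" if "y \<in> ?t ` (UNIV - {0})" for y
  proof -
    from that obtain x where x: "x \<noteq> 0" "y = \<tau> x / x" by blast
    show ?thesis
      unfolding x(2)
    proof (rule card_fibre_projective[OF x(1)])
      fix z assume "z \<in> UNIV - {0}" "\<tau> z / z = \<tau> x / x"
      then have eq: "\<tau> z * x = \<tau> x * z" using x(1) by (simp add: field_simps)
      have "\<tau> (z / x) * \<tau> x = \<tau> z"
        using x(1) by (simp flip: \<tau>_mult)
      then have "\<tau> (z / x) = \<tau> z / \<tau> x"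
        using \<tau>_nz[OF x(1)] by (metis nonzero_mult_div_cancel_right)
      also have "\<dots> = z / x"
        using eq x(1) \<tau>_nz[OF x(1)] by (simp add: frac_eq_eq ac_simps)
      finally have "\<tau> (z / x) = z / x" .
      then show "z / x \<in> range h" using \<tau>(2) by blast
    qed (use x \<tau>_mult \<tau>_h in auto)
  qed
  have fib_g: "card {x \<in> ?S. ?g x = y} = q - 1" if "y \<in> ?g ` ?S" for y
  proof -
    from that obtain x where x: "x \<noteq> 0" "x \<in> X" "y = f x / (\<rho> * x)" by blast
    show ?thesis
      unfolding x(3)
    proof (rule card_fibre_projective[OF x(1)])
      fix z assume z: "z \<in> ?S" "f z / (\<rho> * z) = f x / (\<rho> * x)"
      then have "f z / z = f x / x" using \<open>\<rho> \<noteq> 0\<close> x(1) by (simp add: field_simps)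
      then show "z / x \<in> range h" using z x by (intro ratio) auto
    qed (use x X_scale in auto)
  qed
  \<comment> \<open>Both quotient maps have the same image and fibres of size q - 1, hence domains
    of equal size.\<close>
  have "card ?S = (q - 1) * card (?g ` ?S)"
    using fib_g by (intro card_constant_fibres) auto
  also have "\<dots> = card (UNIV - {0 :: 'a})"
    unfolding im using fib_t by (intro card_constant_fibres[symmetric]) auto
  finally have "?S = UNIV - {0}"
    by (intro card_subset_eq) auto
  moreover have "0 \<in> X"
    using fq unfolding X_def by (auto simp: fq_subspace_iff intro: exI[of _ 0])
  ultimately have X: "x \<in> X" for x by blast
  have f_add: "f (x + y) = f x + f y" for x y
  proof -
    have "(x *s w + f x *s v) + (y *s w + f y *s v) \<in> U"
      using fq f X unfolding fq_subspace_iff by blast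
    then have "(x + y) *s w + (f x + f y) *s v \<in> U"
      by (simp add: vec.scale_left_distrib algebra_simps)
    then show ?thesis using f_eq by metis
  qed
  \<comment> \<open>Division by \<open>\<rho>\<close> normalizes the quotients to the values
    \<tau>(c)/c of norm 1.\<close>
  obtain b k where bk: "b \<noteq> 0" "k < n" "gcd k n = 1" "\<And>x. f x / \<rho> = b * x ^ (q ^ k)"
  proof (rule linearized_norm_one_quotients[of "\<lambda>x. f x / \<rho>"])
    show "y / x \<in> range h" if "x \<noteq> 0" "y \<noteq> 0" "f y / \<rho> / y = f x / \<rho> / x" for x y
      using that X \<open>\<rho> \<noteq> 0\<close> by (intro ratio) (auto simp: field_simps)
    show "(f x / \<rho> / x) ^ norm_exp = 1" if "x \<noteq> 0" for x
    proof -
      have "f x / \<rho> / x \<in> ?t ` (UNIV - {0})"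
        unfolding im[symmetric] using X that by (intro image_eqI[of _ _ x]) auto
      then obtain c where c: "c \<noteq> 0" "f x / \<rho> / x = \<tau> c / c" by blast
      show ?thesis unfolding c(2) by (rule \<tau>_norm[OF c(1)])
    qed
  qed (use f_add X_scale X in \<open>auto simp: add_divide_distrib\<close>)
  have f_b: "f x = \<rho> * b * x ^ (q ^ k)" for x
    using bk(4)[of x] \<open>\<rho> \<noteq> 0\<close> by (simp add: field_simps)
  \<comment> \<open>Rescaling the second basis vector absorbs both constants and leaves a pure
    Frobenius graph.\<close>
  let ?v = "(\<rho> * b) *s v"
  have r_U: "r \<inter> U = {x *s w + x ^ (q ^ k) *s ?v | x. True}"
  proof
    show "r \<inter> U \<subseteq> {x *s w + x ^ (q ^ k) *s ?v | x. True}"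
    proof
      fix u assume u: "u \<in> r \<inter> U"
      have "\<exists>x y. u = x *s w + y *s v"
      proof (cases "u = 0")
        case True
        then have "u = 0 *s w + 0 *s v" by simp
        then show ?thesis by blast
      next
        case False
        then show ?thesis using elem u by blast
      qed
      then obtain x y where xy: "u = x *s w + y *s v" by blast
      then have "y = f x" using f_eq u by blast
      then have "u = x *s w + x ^ (q ^ k) *s ?v"
        using xy f_b by (simp add: ac_simps)
      then show "u \<in> {x *s w + x ^ (q ^ k) *s ?v | x. True}" by blast
    qed
    show "{x *s w + x ^ (q ^ k) *s ?v | x. True} \<subseteq> r \<inter> U"
    proof clarify
      fix x
      have eq: "x *s w + x ^ (q ^ k) *s ?v = x *s w + f x *s v"
        by (simp add: f_b ac_simps)
      show "x *s w + x ^ (q ^ k) *s ?v \<in> r \<inter> U"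
        unfolding eq using f[OF X] in_r by blast
    qed
  qed
  have indep': "a = 0 \<and> c = 0" if "a *s w + c *s ?v = 0" for a c
    using indep[of a "c * (\<rho> * b)"] that \<open>\<rho> \<noteq> 0\<close> bk(1) by simp
  have v_r: "?v \<in> r" using wv sub by (intro vec.subspace_scale)
  show thesis
    by (rule that[OF line wv(1) v_r indep' bk(2,3) r_U])
qed

section \<open>Reduction to the normal form\<close>

lemma U_st_iff: "z \<in> U_st q s t \<longleftrightarrow> z $ 2 = (z $ 1) ^ (q ^ s) \<and> z $ 4 = (z $ 3 :: 'a) ^ (q ^ t)"
proof
  assume "z \<in> U_st q s t"
  then show "z $ 2 = (z $ 1) ^ (q ^ s) \<and> z $ 4 = (z $ 3) ^ (q ^ t)"
    by (auto simp: U_st_def vector_4_nth)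
next
  assume "z $ 2 = (z $ 1) ^ (q ^ s) \<and> z $ 4 = (z $ 3) ^ (q ^ t)"
  then have "z = vector [z $ 1, (z $ 1) ^ (q ^ s), z $ 3, (z $ 3) ^ (q ^ t)]"
    by (simp add: vec_eq_iff forall_4 vector_4_nth)
  then show "z \<in> U_st q s t"
    unfolding U_st_def by blast
qed

text \<open>The equivalence is the inverse of \<open>g\<close>, with the identity as companion
  automorphism.\<close>

lemma proj_equivalent_linear_image:
  fixes g :: "'a ^ 'd \<Rightarrow> 'a ^ 'd"
  assumes add: "\<And>u v. g (u + v) = g u + g v" and scale: "\<And>c v. g (c *s v) = c *s g v"
    and "inj g"
  shows "proj_equivalent (linear_set (g ` U)) (linear_set U)"
proof -
  have bij: "bij g"
    using \<open>inj g\<close> finite_UNIV_inj_surj[of g] by (auto simp: bij_def)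
  define f where "f = inv g"
  have gf: "g (f y) = y" and fg: "f (g x) = x" for x y
    using bij by (auto simp: f_def bij_def surj_f_inv_f)
  have f_add: "f (u + v) = f u + f v" for u v
    using fg[of "f u + f v"] by (simp add: add gf)
  have f_scale: "f (c *s v) = c *s f v" for c v
    using fg[of "c *s f v"] by (simp add: scale gf)
  have "semilinear_bij id f"
    using bij bij_imp_bij_inv[OF bij] f_add f_scale
    by (auto simp: semilinear_bij_def field_aut_def field_hom_def f_def)
  moreover have "f ` vec.span {u} = vec.span {f u}" for u
    by (auto simp: vec.span_singleton f_scale image_iff)
  moreover
  have g_0: "g u = 0 \<longleftrightarrow> u = 0" for u
    using add[of 0 0] \<open>inj g\<close> by (auto simp: inj_def)
  have "(\<lambda>P. f ` P) ` linear_set (g ` U) = linear_set U"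
  proof -
    have "linear_set (g ` U) = (\<lambda>u. vec.span {g u}) ` (U - {0})"
      using g_0 by (auto simp: linear_set_def image_iff)
    then have "(\<lambda>P. f ` P) ` linear_set (g ` U) = (\<lambda>u. f ` vec.span {g u}) ` (U - {0})"
      by (simp add: image_image)
    also have "\<dots> = linear_set U"
      by (auto simp: linear_set_def \<open>\<And>u. f ` vec.span {u} = vec.span {f u}\<close> fg)
    finally show ?thesis .
  qed
  ultimately show ?thesis
    unfolding proj_equivalent_def by blast
qed

lemma card_frob_graph:
  fixes w v :: "'a ^ 'd"
  assumes "\<And>a b. a *s w + b *s v = 0 \<Longrightarrow> a = 0 \<and> b = 0"
  shows "card {x *s w + x ^ (q ^ k) *s v | x. True} = q ^ n"
proof -
  let ?g = "\<lambda>x. x *s w + x ^ (q ^ k) *s v"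
  have "inj ?g"
  proof (rule injI)
    fix x y assume "?g x = ?g y"
    then have "(x - y) *s w + (x ^ (q ^ k) - y ^ (q ^ k)) *s v = 0"
      by (simp add: vec.scale_left_diff_distrib algebra_simps)
    then have "x - y = 0" using assms by blast
    then show "x = y" by simp
  qed
  moreover have "{?g x | x. True} = range ?g" by auto
  ultimately show ?thesis by (simp add: card_image card_a)
qed

lemma max_scattered_two_pseudoregulus_lines:
  fixes U :: "('a ^ 4) set"
  assumes n: "n \<ge> 3" and U: "max_scattered h n U" and "r1 \<noteq> r2"
    and r1: "line_of_pseudoregulus_type h (linear_set U) r1"
    and r2: "line_of_pseudoregulus_type h (linear_set U) r2"
  shows "\<exists>s\<in>{1..n-1}. \<exists>t\<in>{1..n-1}. gcd s n = 1 \<and> gcd t n = 1 \<and>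
           proj_equivalent (linear_set U) (linear_set (U_st q s t))"
proof -
  have sc: "scattered h U" and card_U: "card U = q ^ (2 * n)"
    using U by (auto simp: max_scattered_4_iff)
  have fq: "fq_subspace h U" using sc by (simp add: scattered_iff)
  obtain w v s where r1: "pg_line r1" "w \<in> r1" "v \<in> r1"
      "\<And>a b. a *s w + b *s v = 0 \<Longrightarrow> a = 0 \<and> b = 0"
      "s < n" "gcd s n = 1" "r1 \<inter> U = {x *s w + x ^ (q ^ s) *s v | x. True}"
    by (rule long_line_of_pseudoregulus_type[OF sc r1], (rule that; (assumption | blast)))
  obtain w' v' t where r2: "pg_line r2" "w' \<in> r2" "v' \<in> r2"
      "\<And>a b. a *s w' + b *s v' = 0 \<Longrightarrow> a = 0 \<and> b = 0"
      "t < n" "gcd t n = 1" "r2 \<inter> U = {x *s w' + x ^ (q ^ t) *s v' | x. True}"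
    by (rule long_line_of_pseudoregulus_type[OF sc r2], (rule that; (assumption | blast)))
  have card12: "card (r1 \<inter> U) = q ^ n" "card (r2 \<inter> U) = q ^ n"
    unfolding r1(7) r2(7) using card_frob_graph[OF r1(4)] card_frob_graph[OF r2(4)] by auto
  then have disj: "r1 \<inter> r2 = {0}"
    using long_lines_disjoint[OF n sc _ _ \<open>r1 \<noteq> r2\<close>] long_line_iff[OF fq] r1(1) r2(1) by blast
  have sub: "vec.subspace r1" "vec.subspace r2"
    using r1(1) r2(1) by (auto simp: pg_line_def)
  have U_sum: "U = {u + u' | u u'. u \<in> r1 \<inter> U \<and> u' \<in> r2 \<inter> U}"
    by (rule scattered_eq_sum_of_long_lines[OF fq card_U card12 sub disj])
  \<comment> \<open>The change of basis from standard coordinates to the bases found on the two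
    lines; it carries \<open>U_st q s t\<close> onto U.\<close>
  define g where "g = (\<lambda>z :: 'a ^ 4. z $ 1 *s w + z $ 2 *s v + (z $ 3 *s w' + z $ 4 *s v'))"
  have g_add: "g (x + y) = g x + g y" for x y
    by (simp add: g_def vec.scale_left_distrib algebra_simps)
  have g_scale: "g (c *s x) = c *s g x" for c x
    by (simp add: g_def vec.scale_right_distrib)
  have "inj g"
  proof (rule injI)
    fix x y assume "g x = g y"
    let ?z = "x - y"
    have "g ?z + g y = g x" by (simp flip: g_add)
    then have gz: "g ?z = 0" using \<open>g x = g y\<close> by simp
    let ?a = "?z $ 1 *s w + ?z $ 2 *s v" and ?b = "?z $ 3 *s w' + ?z $ 4 *s v'"
    have "?a + ?b = 0" using gz unfolding g_def .
    then have "?a = - ?b" by (simp only: eq_neg_iff_add_eq_0)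
    moreover have "?a \<in> r1"
      by (intro vec.subspace_add vec.subspace_scale sub r1(2,3))
    moreover have "- ?b \<in> r2"
      by (intro vec.subspace_neg vec.subspace_add vec.subspace_scale sub r2(2,3))
    ultimately have "?a \<in> r1 \<inter> r2" by (metis IntI)
    then have "?a = 0" using disj by blast
    moreover have "?b = 0" using \<open>?a = 0\<close> \<open>?a = - ?b\<close> by (metis neg_equal_0_iff_equal)
    ultimately have "?z $ 1 = 0 \<and> ?z $ 2 = 0" "?z $ 3 = 0 \<and> ?z $ 4 = 0"
      using r1(4) r2(4) by blast+
    then have "?z = 0" by (simp add: vec_eq_iff forall_4)
    then show "x = y" by simp
  qed
  have "g ` U_st q s t = U"
  proof
    show "g ` U_st q s t \<subseteq> U"
    proof clarify
      fix z :: "'a ^ 4" assume "z \<in> U_st q s t"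
      then have z: "g z = (z $ 1 *s w + (z $ 1) ^ (q ^ s) *s v) + (z $ 3 *s w' + (z $ 3) ^ (q ^ t) *s v')"
        by (simp add: g_def U_st_iff)
      have "z $ 1 *s w + (z $ 1) ^ (q ^ s) *s v \<in> r1 \<inter> U"
        unfolding r1(7) by blast
      moreover have "z $ 3 *s w' + (z $ 3) ^ (q ^ t) *s v' \<in> r2 \<inter> U"
        unfolding r2(7) by blast
      ultimately show "g z \<in> U"
        using fq unfolding z fq_subspace_iff by blast
    qed
    show "U \<subseteq> g ` U_st q s t"
    proof
      fix u assume "u \<in> U"
      then obtain u1 u2 where u: "u = u1 + u2" "u1 \<in> r1 \<inter> U" "u2 \<in> r2 \<inter> U"
        using U_sum by blast
      obtain x where x: "u1 = x *s w + x ^ (q ^ s) *s v" using u(2) unfolding r1(7) by blast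
      obtain y where y: "u2 = y *s w' + y ^ (q ^ t) *s v'" using u(3) unfolding r2(7) by blast
      have "u = g (vector [x, x ^ (q ^ s), y, y ^ (q ^ t)])"
        by (simp add: g_def vector_4_nth u x y)
      moreover have "vector [x, x ^ (q ^ s), y, y ^ (q ^ t)] \<in> U_st q s t"
        unfolding U_st_def by blast
      ultimately show "u \<in> g ` U_st q s t" by blast
    qed
  qed
  then have "proj_equivalent (linear_set U) (linear_set (U_st q s t))"
    using proj_equivalent_linear_image[OF g_add g_scale \<open>inj g\<close>, of "U_st q s t"] by simp
  \<comment> \<open>The exponent 0 is excluded because gcd(0, n) = n is at least 3.\<close>
  moreover have "s \<noteq> 0"
    using r1(6) n by (cases "s = 0") simp_all
  moreover have "t \<noteq> 0"
    using r2(6) n by (cases "t = 0") simp_all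
  ultimately show ?thesis
    using r1(5,6) r2(5,6) by (intro bexI[of _ s] bexI[of _ t]) auto
qed

end

subsection \<open>The linear sets \<open>L_{s,t}\<close>\<close>

text \<open>
  The coordinates are indexed by \<open>(i, j, k, l)\<close> so that both \<open>L_{s,s}\<close> and, because
  \<open>y' = y^{q^{n-s}}\<close> means \<open>y = y'^{q^s}\<close>, also \<open>L_{s,n-s}\<close> are instances with \<open>s = t\<close>.
\<close>

locale frobenius_graph = finite_field_extension h q n
  for h :: "'k::{field,finite} \<Rightarrow> 'a::{field,finite}" and q n :: nat +
  fixes i j k l :: 4 and s t :: nat
  assumes n_ge_3: "n \<ge> 3" and distinct_indices: "distinct [i, j, k, l]"
    and s_less: "s < n" and t_less: "t < n" and gcd_s: "gcd s n = 1" and gcd_t: "gcd t n = 1"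
begin

definition mk :: "'a \<Rightarrow> 'a \<Rightarrow> 'a \<Rightarrow> 'a \<Rightarrow> 'a ^ 4" where
  "mk a b c d = (\<chi> m. if m = i then a else if m = j then b else if m = k then c else d)"

lemma mk_nth [simp]: "mk a b c d $ i = a" "mk a b c d $ j = b" "mk a b c d $ k = c" "mk a b c d $ l = d"
  using distinct_indices by (auto simp: mk_def)

lemma eq_iff_coords: "z = z' \<longleftrightarrow> z $ i = z' $ i \<and> z $ j = z' $ j \<and> z $ k = z' $ k \<and> z $ l = z' $ l"
proof -
  have "card {i, j, k, l} = CARD(4)"
    using distinct_indices by simp
  then have "{i, j, k, l} = UNIV"
    by (intro card_subset_eq) auto
  then have "(\<forall>m. z $ m = z' $ m) \<longleftrightarrow> (\<forall>m\<in>{i, j, k, l}. z $ m = z' $ m)"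
    by simp
  then show ?thesis by (simp add: vec_eq_iff)
qed

definition G :: "('a ^ 4) set" where
  "G = {z. z $ j = (z $ i) ^ (q ^ s) \<and> z $ l = (z $ k) ^ (q ^ t)}"

definition W1 :: "('a ^ 4) set" where "W1 = {z. z $ k = 0 \<and> z $ l = 0}"
definition W2 :: "('a ^ 4) set" where "W2 = {z. z $ i = 0 \<and> z $ j = 0}"

lemma s_pos: "s \<noteq> 0"
proof
  assume "s = 0"
  then show False using gcd_s n_ge_3 by simp
qed

lemma t_pos: "t \<noteq> 0"
proof
  assume "t = 0"
  then show False using gcd_t n_ge_3 by simp
qed

lemma fq_subspace_G: "fq_subspace h G"
  by (auto simp: fq_subspace_iff G_def frob_add power_mult_distrib frob_h)

lemma card_G: "card G = q ^ (2 * n)"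
proof -
  let ?g = "\<lambda>(x, y). mk x (x ^ (q ^ s)) y (y ^ (q ^ t))"
  have "inj ?g" by (auto simp: inj_def eq_iff_coords)
  moreover have "G = range ?g"
    by (auto simp: G_def image_iff eq_iff_coords)
  ultimately show ?thesis
    by (simp add: card_image card_prod card_a mult_2 power_add)
qed

text \<open>If u and c u both lie in the graph, a nonzero coordinate of u shows that c is fixed by a
  Frobenius power whose exponent is coprime to n.\<close>

lemma scattered_G: "scattered h G"
  unfolding scattered_iff
proof (intro conjI ballI allI impI)
  fix u :: "'a ^ 4" and c assume u: "u \<in> G" "u \<noteq> 0" "c *s u \<in> G"
  have *: "c ^ (q ^ m) = c" if "c * x ^ (q ^ m) = (c * x) ^ (q ^ m)" "x \<noteq> 0" for x m
    using that by (simp add: power_mult_distrib)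
  have "u $ i \<noteq> 0 \<or> u $ k \<noteq> 0"
    using u(1,2) q_ge_2 by (auto simp: G_def eq_iff_coords)
  then show "c \<in> range h"
  proof
    assume "u $ i \<noteq> 0"
    then have "c ^ (q ^ s) = c" using u by (intro *[of "u $ i"]) (auto simp: G_def)
    then show ?thesis by (rule frob_fixed[OF gcd_s])
  next
    assume "u $ k \<noteq> 0"
    then have "c ^ (q ^ t) = c" using u by (intro *[of "u $ k"]) (auto simp: G_def)
    then show ?thesis by (rule frob_fixed[OF gcd_t])
  qed
qed (rule fq_subspace_G)

lemma fq_dim_G: "fq_dim h G = 2 * n"
  using fq_dim_eq_iff[OF fq_subspace_G] card_G by simp

lemma pg_lineI:
  fixes g :: "'a \<times> 'a \<Rightarrow> 'a ^ 4"
  assumes "vec.subspace W" "inj g" "W = range g"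
  shows "pg_line W"
  using assms by (simp add: pg_line_iff_card card_image card_prod card_a mult_2 power_add)

lemma pg_line_pencil: "pg_line {z :: 'a ^ 4. z $ k = a * z $ i \<and> z $ l = b * z $ j}"
proof (rule pg_lineI)
  show "vec.subspace {z :: 'a ^ 4. z $ k = a * z $ i \<and> z $ l = b * z $ j}"
    by (auto simp: vec.subspace_def algebra_simps)
  show "inj (\<lambda>(x, y). mk x y (a * x) (b * y))"
    by (auto simp: inj_def eq_iff_coords)
  show "{z. z $ k = a * z $ i \<and> z $ l = b * z $ j} = range (\<lambda>(x, y). mk x y (a * x) (b * y))"
    by (auto simp: image_iff eq_iff_coords)
qed

lemma pg_line_W1: "pg_line W1"
  using pg_line_pencil[of 0 0] by (simp add: W1_def)

lemma pg_line_W2: "pg_line W2"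
proof (rule pg_lineI)
  show "vec.subspace W2"
    by (auto simp: W2_def vec.subspace_def)
  show "inj (\<lambda>(x, y). mk 0 0 x y)"
    by (auto simp: inj_def eq_iff_coords)
  show "W2 = range (\<lambda>(x, y). mk 0 0 x y)"
    by (auto simp: W2_def image_iff eq_iff_coords)
qed

lemma long_line_GI:
  fixes g :: "'a \<Rightarrow> 'a ^ 4"
  assumes "pg_line W" "inj g" "W \<inter> G = range g"
  shows "long_line h n G W"
  using assms by (simp add: long_line_iff[OF fq_subspace_G] card_image card_a)

lemma long_line_W1: "long_line h n G W1"
proof (rule long_line_GI[OF pg_line_W1])
  show "inj (\<lambda>x. mk x (x ^ (q ^ s)) 0 0)"
    by (auto simp: inj_def eq_iff_coords)
  show "W1 \<inter> G = range (\<lambda>x. mk x (x ^ (q ^ s)) 0 0)"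
    by (auto simp: W1_def G_def image_iff eq_iff_coords)
qed

lemma long_line_W2: "long_line h n G W2"
proof (rule long_line_GI[OF pg_line_W2])
  show "inj (\<lambda>x. mk 0 0 x (x ^ (q ^ t)))"
    by (auto simp: inj_def eq_iff_coords)
  show "W2 \<inter> G = range (\<lambda>x. mk 0 0 x (x ^ (q ^ t)))"
    by (auto simp: W2_def G_def image_iff eq_iff_coords)
qed

text \<open>A third long line is disjoint from \<open>W1\<close> and \<open>W2\<close>, hence the
  graph of a linear map from \<open>W1\<close> to \<open>W2\<close> with matrix rows (a, b) and (c,
  d). Its q^n vectors in \<open>G\<close> realize every first coordinate x, which yields the
  identity. If a and c both vanished, the line would meet \<open>W1\<close>.\<close>

lemma long_line_frobenius_equation:
  assumes W: "long_line h n G W" "W \<noteq> W1" "W \<noteq> W2"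
  obtains a b c d :: 'a where "\<And>x. c * x + d * x ^ (q ^ s) = (a * x + b * x ^ (q ^ s)) ^ (q ^ t)"
    "\<not> (a = 0 \<and> c = 0)"
proof -
  have disj: "W \<inter> W1 = {0}" "W \<inter> W2 = {0}"
    using long_lines_disjoint[OF n_ge_3 scattered_G W(1)] long_line_W1 long_line_W2 W(2,3) by auto
  have line: "pg_line W" and card_WG: "card (W \<inter> G) = q ^ n"
    using W(1) by (auto simp: long_line_iff[OF fq_subspace_G])
  then have sub: "vec.subspace W" and card_W: "card W = q ^ (2 * n)"
    by (auto simp: pg_line_iff_card)
  let ?p = "\<lambda>z :: 'a ^ 4. (z $ i, z $ j)"
  have inj: "inj_on ?p W"
  proof (rule inj_onI)
    fix z z' assume z: "z \<in> W" "z' \<in> W" "?p z = ?p z'"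
    then have "z - z' \<in> W \<inter> W2"
      using sub by (auto simp: W2_def intro: vec.subspace_diff)
    then show "z = z'" using disj by auto
  qed
  then have "card (?p ` W) = card (UNIV :: ('a \<times> 'a) set)"
    by (simp add: card_image card_W card_prod card_a mult_2 power_add)
  then have surj: "?p ` W = UNIV"
    by (intro card_subset_eq) auto
  have "\<exists>z\<in>W. z $ i = x \<and> z $ j = y" for x y
  proof -
    have "(x, y) \<in> ?p ` W" unfolding surj by simp
    then show ?thesis by blast
  qed
  then obtain e e' where e: "e \<in> W" "e $ i = 1" "e $ j = 0" and e': "e' \<in> W" "e' $ i = 0" "e' $ j = 1"
    by metis
  have W_eq: "z = z $ i *s e + z $ j *s e'" if "z \<in> W" for z
  proof (rule inj_onD[OF inj])
    show "z $ i *s e + z $ j *s e' \<in> W"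
      using sub e e' by (intro vec.subspace_add vec.subspace_scale)
  qed (use that e e' in auto)
  have inj_G: "inj_on (\<lambda>z. z $ i) (W \<inter> G)"
    by (rule inj_onI, rule inj_onD[OF inj]) (auto simp: G_def)
  then have "card ((\<lambda>z. z $ i) ` (W \<inter> G)) = card (UNIV :: 'a set)"
    by (simp add: card_image card_WG card_a)
  then have surj_G: "(\<lambda>z. z $ i) ` (W \<inter> G) = UNIV"
    by (intro card_subset_eq) auto
  have eq: "e $ l * x + e' $ l * x ^ (q ^ s) = (e $ k * x + e' $ k * x ^ (q ^ s)) ^ (q ^ t)" for x
  proof -
    have "x \<in> (\<lambda>z. z $ i) ` (W \<inter> G)" using surj_G by simp
    then obtain z where z: "z \<in> W" "z \<in> G" "z $ i = x" by blast
    have zj: "z $ j = x ^ (q ^ s)" and zl: "z $ l = (z $ k) ^ (q ^ t)"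
      using z by (auto simp: G_def)
    have "z = x *s e + x ^ (q ^ s) *s e'"
      using W_eq[OF z(1)] z(3) zj by simp
    then have "z $ k = e $ k * x + e' $ k * x ^ (q ^ s)" "z $ l = e $ l * x + e' $ l * x ^ (q ^ s)"
      by (simp_all add: mult.commute)
    then show ?thesis using zl by simp
  qed
  have nz: "\<not> (e $ k = 0 \<and> e $ l = 0)"
  proof
    assume "e $ k = 0 \<and> e $ l = 0"
    then have "e \<in> W \<inter> W1" using e by (simp add: W1_def)
    then have "e = 0" using disj by blast
    then show False using e by simp
  qed
  show thesis by (rule that[OF eq nz])
qed

text \<open>Both sides are linearized polynomials in x, with exponents t and s + t modulo n on one
  side and 0 and s on the other; their coefficients are unique.\<close>

lemma frobenius_equation_coefficients:
  fixes a b c d :: 'a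
  assumes "\<And>x. c * x + d * x ^ (q ^ s) = (a * x + b * x ^ (q ^ s)) ^ (q ^ t)" and "m < n"
  shows "(if m = t then a ^ (q ^ t) else 0) + (if m = (s + t) mod n then b ^ (q ^ t) else 0)
           = (if m = 0 then c else 0) + (if m = s then d else 0)"
proof -
  let ?e = "(s + t) mod n"
  define A where "A = (\<lambda>m. (if m = t then a ^ (q ^ t) else 0) + (if m = ?e then b ^ (q ^ t) else 0)
           - ((if m = 0 then c else 0) + (if m = s then d else 0)))"
  have "(\<Sum>m<n. A m * x ^ (q ^ m)) = 0" for x
  proof -
    have delta: "(\<Sum>m<n. (if m = r then g else 0) * x ^ (q ^ m)) = g * x ^ (q ^ r)" if "r < n" for r g
    proof -
      have "(\<Sum>m<n. (if m = r then g else 0) * x ^ (q ^ m)) = (\<Sum>m<n. if m = r then g * x ^ (q ^ m) else 0)"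
        by (intro sum.cong) auto
      then show ?thesis using that by simp
    qed
    have "(\<Sum>m<n. A m * x ^ (q ^ m)) =
        a ^ (q ^ t) * x ^ (q ^ t) + b ^ (q ^ t) * x ^ (q ^ ?e) - (c * x ^ (q ^ 0) + d * x ^ (q ^ s))"
      unfolding A_def left_diff_distrib distrib_right sum_subtractf sum.distrib
      using s_less t_less n_pos by (simp only: delta mod_less_divisor)
    also have "x ^ (q ^ ?e) = (x ^ (q ^ s)) ^ (q ^ t)"
      unfolding frob_frob by (rule frob_cong) simp
    finally show ?thesis
      using assms(1)[of x] by (simp add: frob_add power_mult_distrib)
  qed
  then have "A m = 0"
    using assms(2) by (rule linearized_coefficients_unique)
  then show ?thesis by (simp add: A_def)
qed

lemma shift_mod: "(s + t) mod n = (if s + t < n then s + t else s + t - n)"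
  using s_less t_less by (simp add: mod_if)

lemma only_two_long_lines:
  assumes "s \<noteq> t" "s + t \<noteq> n"
  shows "{W. long_line h n G W} = {W1, W2}"
proof -
  have False if W: "long_line h n G W" "W \<noteq> W1" "W \<noteq> W2" for W
  proof (rule long_line_frobenius_equation[OF W])
    fix a b c d :: 'a
    assume eq: "\<And>x. c * x + d * x ^ (q ^ s) = (a * x + b * x ^ (q ^ s)) ^ (q ^ t)"
      and ac: "\<not> (a = 0 \<and> c = 0)"
    \<comment> \<open>Under the two inequalities the exponent t differs from 0, s and s + t modulo
      n, so its coefficient stands alone. The same holds for the exponent 0 and c.\<close>
    have "a = 0"
      using frobenius_equation_coefficients[OF eq t_less] assms s_pos t_pos s_less shift_mod
      by (auto split: if_splits)
    moreover have "c = 0"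
      using frobenius_equation_coefficients[OF eq n_pos] assms s_pos t_pos shift_mod
      by (auto split: if_splits)
    ultimately show False using ac by blast
  qed
  then show ?thesis using long_line_W1 long_line_W2 by blast
qed

text \<open>Two long lines are too few for the q^n + 1 that a pseudoregulus needs.\<close>

lemma not_pseudoregulus_type:
  assumes "s \<noteq> t" "s + t \<noteq> n"
  shows "\<not> pseudoregulus_type h n G"
proof
  assume "pseudoregulus_type h n G"
  then obtain S where S: "\<forall>W\<in>S. long_line h n G W" "card S = CARD('a) + 1"
    unfolding pseudoregulus_type_def by (elim conjE exE) (rule that)
  then have "S \<subseteq> {W1, W2}"
    using only_two_long_lines[OF assms] by blast
  then have "card S \<le> card {W1, W2}"
    by (intro card_mono) auto
  also have "\<dots> \<le> 2"
    by (simp add: card_insert_if)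
  finally have "q ^ n \<le> 1" using S(2) card_a by simp
  moreover have "1 < q ^ n" using q_ge_2 n_pos by (intro one_less_power) auto
  ultimately show False by simp
qed

section \<open>The pseudoregulus when s = t\<close>

definition pencil :: "'a \<Rightarrow> ('a ^ 4) set" where
  "pencil a = {z. z $ k = a * z $ i \<and> z $ l = a ^ (q ^ s) * z $ j}"

text \<open>The common vectors are those of \<open>G\<close> whose coordinate \<open>k\<close> is a
  times coordinate \<open>i\<close>: with s = t, the Frobenius power respects this multiplication.
  The value a = 0 gives \<open>W1\<close>.\<close>

lemma long_line_pencil:
  assumes "s = t"
  shows "long_line h n G (pencil a)"
proof (rule long_line_GI)
  show "pg_line (pencil a)"
    unfolding pencil_def by (rule pg_line_pencil)
  show "inj (\<lambda>x. mk x (x ^ (q ^ s)) (a * x) ((a * x) ^ (q ^ s)))"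
    by (auto simp: inj_def eq_iff_coords)
  show "pencil a \<inter> G = range (\<lambda>x. mk x (x ^ (q ^ s)) (a * x) ((a * x) ^ (q ^ s)))"
    unfolding pencil_def G_def unfolding assms[symmetric]
    by (auto simp: image_iff eq_iff_coords power_mult_distrib)
qed

definition T1 :: "('a ^ 4) set" where "T1 = {z. z $ j = 0 \<and> z $ l = 0}"
definition T2 :: "('a ^ 4) set" where "T2 = {z. z $ i = 0 \<and> z $ k = 0}"

lemma pg_line_T1: "pg_line T1"
proof (rule pg_lineI)
  show "vec.subspace T1"
    by (auto simp: T1_def vec.subspace_def)
  show "inj (\<lambda>(x, y). mk x 0 y 0)"
    by (auto simp: inj_def eq_iff_coords)
  show "T1 = range (\<lambda>(x, y). mk x 0 y 0)"
    by (auto simp: T1_def image_iff eq_iff_coords)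
qed

lemma pg_line_T2: "pg_line T2"
proof (rule pg_lineI)
  show "vec.subspace T2"
    by (auto simp: T2_def vec.subspace_def)
  show "inj (\<lambda>(x, y). mk 0 x 0 y)"
    by (auto simp: inj_def eq_iff_coords)
  show "T2 = range (\<lambda>(x, y). mk 0 x 0 y)"
    by (auto simp: T2_def image_iff eq_iff_coords)
qed

text \<open>A transversal is spanned by a vector p of \<open>pencil 0\<close> and a vector p' of
  \<open>W2\<close>. Meeting \<open>pencil a\<close> makes (p'_k, p'_l) proportional to (a p_i,
  a^{q^s} p_j). Eliminating the factor gives an identity in a whose instances determine the
  line.\<close>

lemma transversal_cases:
  assumes T: "pg_line T" and W2: "T \<inter> W2 \<noteq> {0}" and pencil: "\<And>a. T \<inter> pencil a \<noteq> {0}"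
  shows "T = T1 \<or> T = T2"
proof -
  have sub: "vec.subspace T" using T by (simp add: pg_line_def)
  have 0: "0 \<in> T \<inter> W2" "0 \<in> T \<inter> pencil a" for a
    using sub by (auto simp: W2_def pencil_def vec.subspace_0)
  obtain p where p: "p \<in> T" "p \<noteq> 0" "p $ k = 0" "p $ l = 0"
    using pencil[of 0] 0(2)[of 0] q_ge_2 by (auto simp: pencil_def)
  obtain p' where p': "p' \<in> T" "p' \<noteq> 0" "p' $ i = 0" "p' $ j = 0"
    using W2 0(1) by (auto simp: W2_def)
  have "p' \<notin> vec.span {p}"
    using p p' by (auto simp: vec.span_singleton eq_iff_coords)
  then have "T = vec.span {p', p}"
    by (rule pg_line_eq_span[OF T p(1) p'(1) p(2)])
  then have T_eq: "T = {x *s p' + y *s p | x y. True}"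
    by (simp only: span_pair)
  have key: "\<exists>m. m * p' $ k = a * p $ i \<and> m * p' $ l = a ^ (q ^ s) * p $ j" for a
  proof -
    obtain z where z: "z \<in> T" "z \<in> pencil a" "z \<noteq> 0"
      using pencil[of a] 0(2)[of a] by blast
    then obtain x y where xy: "z = x *s p' + y *s p" unfolding T_eq by blast
    have zk: "x * p' $ k = a * (y * p $ i)" and zl: "x * p' $ l = a ^ (q ^ s) * (y * p $ j)"
      using z(2) p p' by (auto simp: xy pencil_def)
    have "y \<noteq> 0"
    proof
      assume "y = 0"
      then have "x = 0" using zk zl p' by (auto simp: eq_iff_coords)
      then show False using \<open>y = 0\<close> xy z(3) by simp
    qed
    then show ?thesis
      using zk zl by (intro exI[of _ "x / y"]) (auto simp: field_simps)
  qed
  have cross: "a * (p $ i * p' $ l) = a ^ (q ^ s) * (p $ j * p' $ k)" for a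
  proof -
    obtain m where m: "m * p' $ k = a * p $ i" "m * p' $ l = a ^ (q ^ s) * p $ j"
      using key by blast
    have "a * (p $ i * p' $ l) = (m * p' $ k) * p' $ l"
      unfolding m(1) by (simp add: mult.assoc)
    also have "\<dots> = (m * p' $ l) * p' $ k" by (simp add: ac_simps)
    finally show ?thesis unfolding m(2) by (simp add: mult.assoc)
  qed
  have eq1: "p $ i * p' $ l = p $ j * p' $ k" using cross[of 1] by simp
  \<comment> \<open>The instance a = 1 equates the two products; an a moved by the Frobenius power
    then forces them to vanish.\<close>
  obtain a where a: "a \<notin> range h" using ex_not_in_range_h n_ge_3 by auto
  then have "a ^ (q ^ s) \<noteq> a" using frob_fixed[OF gcd_s] by blast
  moreover have "(a - a ^ (q ^ s)) * (p $ j * p' $ k) = 0"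
    using cross[of a] unfolding eq1 by (simp add: algebra_simps)
  ultimately have "p $ j = 0 \<or> p' $ k = 0" by auto
  then show ?thesis
  proof
    assume pj: "p $ j = 0"
    then have "p $ i \<noteq> 0" using p by (auto simp: eq_iff_coords)
    then have "p' $ l = 0" using eq1 pj by simp
    then have "T \<subseteq> T1" using pj p p' by (auto simp: T_eq T1_def)
    then show ?thesis using pg_lines_eqI[OF T pg_line_T1] by simp
  next
    assume pk: "p' $ k = 0"
    then have "p' $ l \<noteq> 0" using p' by (auto simp: eq_iff_coords)
    then have "p $ i = 0" using eq1 pk by simp
    then have "T \<subseteq> T2" using pk p p' by (auto simp: T_eq T2_def)
    then show ?thesis using pg_lines_eqI[OF T pg_line_T2] by simp
  qed
qed

lemma pseudoregulus_type_G:
  assumes "s = t"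
  shows "pseudoregulus_type h n G"
proof -
  \<comment> \<open>The lines are parametrized by a projective line over F_{q^n}, with
    \<open>W2\<close> as the value at infinity; this accounts for q^n + 1.\<close>
  define S where "S = insert W2 (range pencil)"
  have long: "long_line h n G W" if "W \<in> S" for W
    using that long_line_pencil[OF assms] long_line_W2 by (auto simp: S_def)
  have sub_S: "vec.subspace W" if "W \<in> S" for W
    using long[OF that] by (simp add: long_line_def pg_line_def)
  have "inj pencil"
  proof (rule injI)
    fix a b assume "pencil a = pencil b"
    moreover have "mk 1 0 a 0 \<in> pencil a" by (simp add: pencil_def)
    ultimately have "mk 1 0 a 0 \<in> pencil b" by simp
    then show "a = b" by (simp add: pencil_def)
  qed
  moreover have "W2 \<notin> range pencil"
  proof
    assume "W2 \<in> range pencil"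
    moreover have "mk 0 0 1 0 \<in> W2" by (simp add: W2_def)
    ultimately obtain a where "mk 0 0 1 0 \<in> pencil a" by blast
    then show False by (simp add: pencil_def)
  qed
  ultimately have card_S: "card S = CARD('a) + 1"
    by (simp add: S_def card_image)
  have disj: "points_of W \<inter> points_of W' = {}" if "W \<in> S" "W' \<in> S" "W \<noteq> W'" for W W'
    using that long_lines_disjoint[OF n_ge_3 scattered_G long long] sub_S
    by (simp add: points_of_disjoint_iff)
  have meets: "points_of T \<inter> points_of W \<noteq> {} \<longleftrightarrow> T \<inter> W \<noteq> {0}" if "pg_line T" "W \<in> S" for T W
    using that sub_S by (simp add: points_of_disjoint_iff pg_line_def)
  have avoid: "points_of T \<inter> linear_set G = {}" if "pg_line T" "T \<inter> G \<subseteq> {0}" for T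
    using that linear_set_Int_points_of[of T G] linear_set_empty_iff[of "T \<inter> G"]
    by (auto simp: pg_line_def Int_commute)
  have "{T. pg_line T \<and> points_of T \<inter> linear_set G = {} \<and>
          (\<forall>W\<in>S. points_of T \<inter> points_of W \<noteq> {})} = {T1, T2}" (is "?X = _")
  proof
    show "?X \<subseteq> {T1, T2}"
    proof
      fix T assume "T \<in> ?X"
      then have T: "pg_line T" "\<forall>W\<in>S. T \<inter> W \<noteq> {0}" using meets by auto
      then have "T \<inter> W2 \<noteq> {0}" "\<And>a. T \<inter> pencil a \<noteq> {0}" by (auto simp: S_def)
      then show "T \<in> {T1, T2}" using transversal_cases[OF T(1)] by blast
    qed
    have "T1 \<inter> W \<noteq> {0}" if "W \<in> S" for W
    proof (cases "W = W2")
      case True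
      have "mk 0 0 1 0 \<in> T1 \<inter> W" "mk 0 0 1 0 \<noteq> 0"
        by (auto simp: True T1_def W2_def eq_iff_coords)
      then show ?thesis by blast
    next
      case False
      then obtain a where a: "W = pencil a" using \<open>W \<in> S\<close> unfolding S_def by blast
      have "mk 1 0 a 0 \<in> T1 \<inter> W" "mk 1 0 a 0 \<noteq> 0"
        by (auto simp: a T1_def pencil_def eq_iff_coords)
      then show ?thesis by blast
    qed
    moreover have "T2 \<inter> W \<noteq> {0}" if "W \<in> S" for W
    proof (cases "W = W2")
      case True
      have "mk 0 0 0 1 \<in> T2 \<inter> W" "mk 0 0 0 1 \<noteq> 0"
        by (auto simp: True T2_def W2_def eq_iff_coords)
      then show ?thesis by blast
    next
      case False
      then obtain a where a: "W = pencil a" using \<open>W \<in> S\<close> unfolding S_def by blast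
      have "mk 0 1 0 (a ^ (q ^ s)) \<in> T2 \<inter> W" "mk 0 1 0 (a ^ (q ^ s)) \<noteq> 0"
        by (auto simp: a T2_def pencil_def eq_iff_coords)
      then show ?thesis by blast
    qed
    moreover have "T1 \<inter> G \<subseteq> {0}" "T2 \<inter> G \<subseteq> {0}"
      using q_ge_2 by (auto simp: T1_def T2_def G_def eq_iff_coords)
    ultimately show "{T1, T2} \<subseteq> ?X"
      using pg_line_T1 pg_line_T2 avoid meets by simp
  qed
  moreover have "T1 \<noteq> T2"
  proof
    assume "T1 = T2"
    moreover have "mk 1 0 0 0 \<in> T1" by (simp add: T1_def)
    ultimately have "mk 1 0 0 0 \<in> T2" by simp
    then show False by (simp add: T2_def)
  qed
  ultimately show ?thesis
    unfolding pseudoregulus_type_def using scattered_G fq_dim_G long card_S disj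
    by (intro conjI exI[of _ S] exI[of _ T1] exI[of _ T2]) auto
qed

end

lemma (in finite_field_extension) U_st_trichotomy:
  assumes n: "n \<ge> 3" and s: "s \<in> {1..n-1}" and t: "t \<in> {1..n-1}"
    and gcd_s: "gcd s n = 1" and gcd_t: "gcd t n = 1"
  shows "(pseudoregulus_type h n (U_st q s t :: ('a ^ 4) set) \<longleftrightarrow> s = t \<or> s = n - t) \<and>
    (s \<noteq> t \<and> s \<noteq> n - t \<longrightarrow>
       n \<ge> 5 \<and>
       {W. long_line h n (U_st q s t) W} =
         {{v :: 'a ^ 4. v $ 3 = 0 \<and> v $ 4 = 0}, {v. v $ 1 = 0 \<and> v $ 2 = 0}})"
proof -
  interpret A: frobenius_graph h q n 1 2 3 4 s t
    by unfold_locales (use assms in auto)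
  have A_G: "A.G = U_st q s t"
    by (auto simp: A.G_def U_st_iff)
  have swapped: "pseudoregulus_type h n (U_st q s t :: ('a ^ 4) set)" if st: "s + t = n"
  proof -
    interpret B: frobenius_graph h q n 1 2 4 3 s s
      by unfold_locales (use assms in auto)
    \<comment> \<open>The Frobenius powers with exponents s and t are inverse to each other, since s
      + t = n.\<close>
    have "z $ 3 = (z $ 4) ^ (q ^ s) \<longleftrightarrow> z $ 4 = (z $ 3) ^ (q ^ t)" for z :: "'a ^ 4"
    proof
      assume "z $ 3 = (z $ 4) ^ (q ^ s)"
      then show "z $ 4 = (z $ 3) ^ (q ^ t)"
        by (simp only: frob_frob st power_card_a)
    next
      assume "z $ 4 = (z $ 3) ^ (q ^ t)"
      then show "z $ 3 = (z $ 4) ^ (q ^ s)"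
        by (simp only: frob_frob add.commute[of t] st power_card_a)
    qed
    then have "B.G = U_st q s t"
      unfolding B.G_def set_eq_iff mem_Collect_eq U_st_iff by blast
    then show ?thesis using B.pseudoregulus_type_G by simp
  qed
  show ?thesis
  proof (cases "s = t \<or> s + t = n")
    case True
    then have "pseudoregulus_type h n (U_st q s t :: ('a ^ 4) set)"
      using A.pseudoregulus_type_G swapped unfolding A_G by blast
    moreover have "s = t \<or> s = n - t" using True by auto
    ultimately show ?thesis by blast
  next
    case False
    then have ne: "s \<noteq> t" "s + t \<noteq> n" "s \<noteq> n - t" using t by auto
    \<comment> \<open>For n = 3 the admissible exponents are 1 and 2, for n = 4 they are 1 and 3;
      any two of them are equal or add up to n.\<close>
    have "n \<ge> 5"
    proof (rule ccontr)
      assume "\<not> n \<ge> 5"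
      then consider "n = 3" | "n = 4" using n by linarith
      then show False
      proof cases
        case 1
        then show False using s t ne by auto
      next
        case 2
        have "gcd 2 4 = (2 :: nat)" by (simp add: gcd_nat.absorb1)
        then have "s \<noteq> 2" "t \<noteq> 2" using gcd_s gcd_t 2 by auto
        then show False using s t ne 2 by auto
      qed
    qed
    moreover have "{W. long_line h n (U_st q s t) W} =
        {{v :: 'a ^ 4. v $ 3 = 0 \<and> v $ 4 = 0}, {v. v $ 1 = 0 \<and> v $ 2 = 0}}"
      using A.only_two_long_lines[OF ne(1,2)] unfolding A_G A.W1_def A.W2_def .
    ultimately show ?thesis
      using A.not_pseudoregulus_type[OF ne(1,2)] ne unfolding A_G by blast
  qed
qed

theorem theorem2p6:
  fixes h :: "'k::{field,finite} \<Rightarrow> 'a::{field,finite}" and q n :: nat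
  assumes "field_hom h"
    and "CARD('k) = q" and "CARD('a) = q ^ n" and "n \<ge> 3"
  shows "(\<forall>U :: ('a ^ 4) set.
            max_scattered h n U \<and>
            (\<exists>r1 r2. r1 \<noteq> r2 \<and> line_of_pseudoregulus_type h (linear_set U) r1 \<and>
                     line_of_pseudoregulus_type h (linear_set U) r2) \<longrightarrow>
            (\<exists>s\<in>{1..n-1}. \<exists>t\<in>{1..n-1}. gcd s n = 1 \<and> gcd t n = 1 \<and>
               proj_equivalent (linear_set U) (linear_set (U_st q s t)))) \<and>
         (\<forall>s\<in>{1..n-1}. \<forall>t\<in>{1..n-1}. gcd s n = 1 \<and> gcd t n = 1 \<longrightarrow>
            (pseudoregulus_type h n (U_st q s t :: ('a ^ 4) set) \<longleftrightarrow> s = t \<or> s = n - t) \<and>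
            (s \<noteq> t \<and> s \<noteq> n - t \<longrightarrow>
               n \<ge> 5 \<and>
               {W. long_line h n (U_st q s t) W} =
                 {{v :: 'a ^ 4. v $ 3 = 0 \<and> v $ 4 = 0}, {v. v $ 1 = 0 \<and> v $ 2 = 0}}))"
proof -
  interpret finite_field_extension h q n
    by unfold_locales (use assms in auto)
  show ?thesis
  proof (intro conjI[of "\<forall>U. _ U"] allI ballI impI)
    fix U :: "('a ^ 4) set"
    assume *: "max_scattered h n U \<and>
      (\<exists>r1 r2. r1 \<noteq> r2 \<and> line_of_pseudoregulus_type h (linear_set U) r1 \<and>
               line_of_pseudoregulus_type h (linear_set U) r2)"
    then obtain r1 r2 where "r1 \<noteq> r2" "line_of_pseudoregulus_type h (linear_set U) r1"
        "line_of_pseudoregulus_type h (linear_set U) r2"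
      by blast
    then show "\<exists>s\<in>{1..n-1}. \<exists>t\<in>{1..n-1}. gcd s n = 1 \<and> gcd t n = 1 \<and>
        proj_equivalent (linear_set U) (linear_set (U_st q s t))"
      using * by (intro max_scattered_two_pseudoregulus_lines[OF assms(4)]) blast+
  next
    fix s t assume "s \<in> {1..n-1}" "t \<in> {1..n-1}" "gcd s n = 1 \<and> gcd t n = 1"
    then show "(pseudoregulus_type h n (U_st q s t :: ('a ^ 4) set) \<longleftrightarrow> s = t \<or> s = n - t) \<and>
            (s \<noteq> t \<and> s \<noteq> n - t \<longrightarrow>
               n \<ge> 5 \<and>
               {W. long_line h n (U_st q s t) W} =
                 {{v :: 'a ^ 4. v $ 3 = 0 \<and> v $ 4 = 0}, {v. v $ 1 = 0 \<and> v $ 2 = 0}})"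
      by (intro U_st_trichotomy[OF assms(4)]) blast+
  qed
qed

end
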